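(* Let $(\bar x,\bar y)\in S_{\rm Lag}(\bar p)$, where $\bar p=(\bar w,0,0)$. For each $\nu=1,\dots,N$, let $f_\nu:\mathbb R^n\times\mathbb R^d\to\mathbb R$ and $F_\nu:\mathbb R^{n_\nu}\times\mathbb R^d\to\mathcal Y_\nu$ be twice differentiable with respect to $x$ (respectively $x^\nu$) in a neighborhood of $(\bar x,\bar w)$ (respectively $(\bar x^\nu,\bar w)$), and suppose that $f_\nu$, $F_\nu$, $\nabla_xf_\nu$ and ${\rm D}_{x^\nu}F_\nu$ are strictly differentiable with respect to $(x,w)$ (respectively $(x^\nu,w)$) in this neighborhood. Then $S_{\rm Lag}$ has the Aubin property at $\bar p$ for $(\bar x,\bar y)$ if and only if the following implication holds for all $w_1=([w_1]_1,\dots,[w_1]_N)\in\mathbb R^n$ and $w_2=([w_2]_1,\dots,[w_2]_N)\in\mathcal Y$: $$\left.\begin{array}{l}\big[\mathbf G^*w_1\big]_\nu-{\rm D}_{x^\nu}g_\nu(\bar x^\nu)^*[w_2]_\nu\in D^*N_{X_\nu}(\bar x^\nu\,|\,-\nabla_{x^\nu}l_\nu(\bar x,\bar y^\nu))(-[w_1]_\nu),\ \nu=1,\dots,N\\ {\rm D}_{x^\nu}g_\nu(\bar x^\nu)[w_1]_\nu\in D^*N_{K_\nu^\circ}(\bar y^\nu\,|\,g_\nu(\bar x^\nu))(-[w_2]_\nu),\ \nu=1,\dots,N\end{array}\right\}\Longrightarrow w_1=0,\ w_2=0,$$ where $[\mathbf G^*w_1]_\nu\in\mathbb R^{n_\nu}$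 is the $\nu$-th block of $\mathbf G^*w_1$.
   Context: **Setting (classical Nash equilibrium problem).** There are $N$ players, $n=n_1+\dots+n_N$, $x=(x^1,\dots,x^N)\in\mathbb R^n$ with $x^\nu\in\mathbb R^{n_\nu}$, and $x^{-\nu}$ denotes the other blocks. For each $\nu$: $X_\nu\subset\mathbb R^{n_\nu}$ is nonempty closed convex, $\mathcal Y_\nu$ is a finite-dimensional Hilbert space, $K_\nu\subset\mathcal Y_\nu$ is a nonempty closed convex cone with polar $K_\nu^\circ=\{y:\langle y,k\rangle\le0\ \forall k\in K_\nu\}$. $\mathcal Y=\prod_\nu\mathcal Y_\nu$. Given $p=(w,v,u)\in\mathbb R^d\times\mathbb R^n\times\mathcal Y$, player $\nu$ minimizes $f_\nu(x^\nu,x^{-\nu};w)-\langle v^\nu,x^\nu\rangle$ over $x^\nu\in X_\nu$ subject to $F_\nu(x^\nu;w)-u^\nu\in K_\nu$ (the constraint depends only on the player's own variable). With $L_\nu(x,y^\nu;w,v^\nu,u^\nu)=f_\nu(x;w)-\langle v^\nu,x^\nu\rangle+\langle y^\nu,F_\nu(x^\nu;w)-u^\nu\rangle$, $$S_{\rm Lag}(p)=\{(x,y)\in\mathbb R^n\times\mathcal Y:\ 0\in\nabla_{x^\nu}L_\nu(x,y^\nu;w,v^\nu,u^\nu)+N_{X_\nu}(x^\nu),\ 0\in-F_\nu(x^\nu;w)+u^\nu+N_{K_\nu^\circ}(y^\nu),\ \nu=1,\dots,N\},$$ where $N_C$ is the normal cone mapping of convex analysis (empty off $C$). **Notation.** Fix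 $\bar w\in\mathbb R^d$; $\theta_\nu=f_\nu(\cdot;\bar w)$, $g_\nu=F_\nu(\cdot;\bar w)$, $l_\nu(x,y^\nu)=\theta_\nu(x)+\langle y^\nu,g_\nu(x^\nu)\rangle$. $\mathbf G$ is the $n\times n$ matrix with $(\nu,\mu)$ block $\nabla^2_{x^\nu x^\mu}l_\nu(\bar x,\bar y^\nu)$ (derivative in $x^\mu$ of $\nabla_{x^\nu}l_\nu$). $^*$ on a linear operator is the adjoint. **Variational notions.** For a set-valued $S$ with $(\bar a,\bar b)\in{\rm gph}\,S$, the coderivative is $D^*S(\bar a|\bar b)(v)=\{w:(w,-v)\in N_{{\rm gph}S}(\bar a,\bar b)\}$, with $N_{{\rm gph}S}$ the limiting (Mordukhovich) normal cone. $S$ has the Aubin property at $\bar a$ for $\bar b\in S(\bar a)$ if there are neighborhoods $U$ of $\bar a$, $V$ of $\bar b$ and $\kappa>0$ with $S(a)\cap V\subset S(a')+\kappa\|a'-a\|\mathbf B$ for all $a,a'\in U$ ($\mathbf B$ the closed unit ball). *)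

theory Defs
  imports "HOL-Analysis.Analysis" "HOL-Library.Set_Algebras"
begin

text \<open>
  \<^bold>\<open>Encoding of the product spaces.\<close>  The blocks may have different dimensions, so both products
  are represented as internal orthogonal direct sums.

  \<^item> The player set is a finite type \<open>'p\<close>.  The decision space is \<open>real^'n\<close>, and \<open>owner i\<close> is the
    player to whom coordinate \<open>i\<close> belongs.  The space of decisions of player \<open>\<nu>\<close> is the coordinate
    subspace \<open>block_space owner \<nu>\<close>, and the block \<open>\<nu>\<close> of \<open>x\<close> is \<open>block owner \<nu> x\<close>, that is, \<open>x\<close> with
    the other coordinates set to \<open>0\<close>.
  \<^item> The product of the multiplier spaces is a Euclidean space \<open>'y\<close>, with the factor of player \<open>\<nu>\<close>
    a subspace \<open>Y \<nu>\<close>; the block \<open>\<nu>\<close> of \<open>y\<close> is its orthogonal projection \<open>component (Y \<nu>) y\<close>.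
  \<^item> A mapping from the decision space of player \<open>\<nu>\<close> times the parameter space into the factor
    of player \<open>\<nu>\<close> is a function \<open>F \<nu>\<close> on the whole decision space times the parameter space that
    depends on \<open>x\<close> only through \<open>block owner \<nu> x\<close> and takes values in \<open>Y \<nu>\<close>.

  Cones and normals of subsets of a block are formed inside that block: the definitions below carry
  the ambient subspace \<open>E\<close> as an argument.
\<close>

definition block_space :: "('n::finite \<Rightarrow> 'p) \<Rightarrow> 'p \<Rightarrow> (real^'n) set" where
  "block_space owner \<nu> = {x. \<forall>i. owner i \<noteq> \<nu> \<longrightarrow> x $ i = 0}"

definition block :: "('n::finite \<Rightarrow> 'p) \<Rightarrow> 'p \<Rightarrow> real^'n \<Rightarrow> real^'n" where
  "block owner \<nu> x = (\<chi> i. if owner i = \<nu> then x $ i else 0)"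

definition orthogonal_decomposition :: "('p \<Rightarrow> 'y::euclidean_space set) \<Rightarrow> bool" where
  "orthogonal_decomposition Y \<longleftrightarrow>
     (\<forall>\<nu>. subspace (Y \<nu>)) \<and>
     (\<forall>\<nu> \<mu>. \<nu> \<noteq> \<mu> \<longrightarrow> (\<forall>a\<in>Y \<nu>. \<forall>b\<in>Y \<mu>. orthogonal a b)) \<and>
     span (\<Union>\<nu>. Y \<nu>) = UNIV"

definition component :: "'y::euclidean_space set \<Rightarrow> 'y \<Rightarrow> 'y" where
  "component E y = (THE z. z \<in> E \<and> y - z \<in> E\<^sup>\<bottom>)"

definition gradient :: "('a::euclidean_space \<Rightarrow> real) \<Rightarrow> 'a \<Rightarrow> 'a" where
  "gradient f x = (THE d. GDERIV f x :> d)"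

text \<open>The gradient with respect to block \<open>\<nu>\<close> with the other blocks held fixed, as an element of
  \<open>block_space owner \<nu>\<close>.\<close>

definition partial_gradient ::
    "('n::finite \<Rightarrow> 'p) \<Rightarrow> 'p \<Rightarrow> (real^'n \<Rightarrow> real) \<Rightarrow> real^'n \<Rightarrow> real^'n" where
  "partial_gradient owner \<nu> f x = gradient (\<lambda>h. f (x + block owner \<nu> h)) 0"

definition grad_x :: "('a::euclidean_space \<times> 'd \<Rightarrow> real) \<Rightarrow> 'a \<times> 'd \<Rightarrow> 'a" where
  "grad_x f = (\<lambda>(x, w). gradient (\<lambda>z. f (z, w)) x)"

definition deriv_x ::
    "('a::euclidean_space \<times> 'd \<Rightarrow> 'b::euclidean_space) \<Rightarrow> 'a \<times> 'd \<Rightarrow> 'a \<Rightarrow>\<^sub>L 'b" where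
  "deriv_x F = (\<lambda>(x, w). Blinfun (frechet_derivative (\<lambda>z. F (z, w)) (at x)))"

definition strictly_differentiable_at ::
    "('a::real_normed_vector \<Rightarrow> 'b::real_normed_vector) \<Rightarrow> 'a \<Rightarrow> bool" where
  "strictly_differentiable_at h z \<longleftrightarrow>
     (\<exists>D. bounded_linear D \<and>
       (\<forall>\<epsilon>>0. \<exists>\<delta>>0. \<forall>a\<in>ball z \<delta>. \<forall>b\<in>ball z \<delta>.
          norm (h a - h b - D (a - b)) \<le> \<epsilon> * norm (a - b)))"

definition polar_cone :: "'a::euclidean_space set \<Rightarrow> 'a set \<Rightarrow> 'a set" where
  "polar_cone E K = {y\<in>E. \<forall>k\<in>K. y \<bullet> k \<le> 0}"

definition convex_normal_cone :: "'a::euclidean_space set \<Rightarrow> 'a set \<Rightarrow> 'a \<Rightarrow> 'a set" where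
  "convex_normal_cone E C x = (if x \<in> C then {v\<in>E. \<forall>z\<in>C. v \<bullet> (z - x) \<le> 0} else {})"

text \<open>The regular (Frechet) normal cone is given by
  \<open>limsup \<langle>v, z - x\<rangle> / \<parallel>z - x\<parallel> \<le> 0\<close> as \<open>z\<close> tends to \<open>x\<close> in \<open>C\<close>, with \<open>z \<noteq> x\<close>.\<close>

definition regular_normal_cone :: "'a::euclidean_space set \<Rightarrow> 'a set \<Rightarrow> 'a \<Rightarrow> 'a set" where
  "regular_normal_cone E C x =
     (if x \<in> C
      then {v\<in>E. \<forall>\<epsilon>>0. \<exists>\<delta>>0. \<forall>z\<in>C. dist z x < \<delta> \<longrightarrow> v \<bullet> (z - x) \<le> \<epsilon> * norm (z - x)}
      else {})"

definition limiting_normal_cone :: "'a::euclidean_space set \<Rightarrow> 'a set \<Rightarrow> 'a \<Rightarrow> 'a set" where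
  "limiting_normal_cone E C x =
     (if x \<in> C
      then {v. \<exists>xs vs. (\<forall>k::nat. xs k \<in> C \<and> vs k \<in> regular_normal_cone E C (xs k)) \<and>
                       xs \<longlonglongrightarrow> x \<and> vs \<longlonglongrightarrow> v}
      else {})"

definition gph :: "('a \<Rightarrow> 'b set) \<Rightarrow> ('a \<times> 'b) set" where
  "gph S = {(a, b). b \<in> S a}"

text \<open>The coderivative of a set-valued mapping from \<open>E\<close> to \<open>E'\<close>.\<close>

definition coderivative ::
    "'a::euclidean_space set \<Rightarrow> 'b::euclidean_space set \<Rightarrow> ('a \<Rightarrow> 'b set) \<Rightarrow> 'a \<Rightarrow> 'b \<Rightarrow> 'b \<Rightarrow> 'a set"
  where
  "coderivative E E' S a b v = {w. (w, - v) \<in> limiting_normal_cone (E \<times> E') (gph S) (a, b)}"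

definition aubin_property ::
    "('a::real_normed_vector \<Rightarrow> 'b::real_normed_vector set) \<Rightarrow> 'a \<Rightarrow> 'b \<Rightarrow> bool" where
  "aubin_property S abar bbar \<longleftrightarrow>
     bbar \<in> S abar \<and>
     (\<exists>U V \<kappa>. open U \<and> abar \<in> U \<and> open V \<and> bbar \<in> V \<and> \<kappa> > 0 \<and>
        (\<forall>a\<in>U. \<forall>a'\<in>U.
           S a \<inter> V \<subseteq> S a' + (\<lambda>b. (\<kappa> * norm (a' - a)) *\<^sub>R b) ` cball 0 1))"

definition lagrangian ::
    "('n::finite \<Rightarrow> 'p) \<Rightarrow> ('p \<Rightarrow> (real^'n) \<times> 'd \<Rightarrow> real) \<Rightarrow> ('p \<Rightarrow> (real^'n) \<times> 'd \<Rightarrow> 'y::euclidean_space)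
     \<Rightarrow> 'p \<Rightarrow> real^'n \<Rightarrow> 'y \<Rightarrow> 'd \<Rightarrow> real^'n \<Rightarrow> 'y \<Rightarrow> real" where
  "lagrangian owner f F \<nu> x \<eta> w \<xi> \<upsilon> =
     f \<nu> (x, w) - \<xi> \<bullet> block owner \<nu> x + \<eta> \<bullet> (F \<nu> (block owner \<nu> x, w) - \<upsilon>)"

definition S_Lag ::
    "('n::finite \<Rightarrow> 'p) \<Rightarrow> ('p \<Rightarrow> 'y::euclidean_space set) \<Rightarrow> ('p \<Rightarrow> (real^'n) set) \<Rightarrow> ('p \<Rightarrow> 'y set)
     \<Rightarrow> ('p \<Rightarrow> (real^'n) \<times> 'd \<Rightarrow> real) \<Rightarrow> ('p \<Rightarrow> (real^'n) \<times> 'd \<Rightarrow> 'y)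
     \<Rightarrow> 'd \<times> (real^'n) \<times> 'y \<Rightarrow> ((real^'n) \<times> 'y) set" where
  "S_Lag owner Y X K f F = (\<lambda>(w, v, u). {(x, y). \<forall>\<nu>.
     0 \<in> partial_gradient owner \<nu>
            (\<lambda>z. lagrangian owner f F \<nu> z (component (Y \<nu>) y) w (block owner \<nu> v) (component (Y \<nu>) u)) x
         +o convex_normal_cone (block_space owner \<nu>) (X \<nu>) (block owner \<nu> x) \<and>
     0 \<in> (- F \<nu> (block owner \<nu> x, w) + component (Y \<nu>) u)
         +o convex_normal_cone (Y \<nu>) (polar_cone (Y \<nu>) (K \<nu>)) (component (Y \<nu>) y)})"

text \<open>The function \<open>l\<^sub>\<nu>\<close>, i.e. the Lagrangian at the reference parameter \<open>(wbar, 0, 0)\<close>.\<close>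

definition ref_lagrangian ::
    "('n::finite \<Rightarrow> 'p) \<Rightarrow> ('p \<Rightarrow> (real^'n) \<times> 'd \<Rightarrow> real) \<Rightarrow> ('p \<Rightarrow> (real^'n) \<times> 'd \<Rightarrow> 'y::euclidean_space)
     \<Rightarrow> 'd \<Rightarrow> 'p \<Rightarrow> real^'n \<Rightarrow> 'y \<Rightarrow> real" where
  "ref_lagrangian owner f F wbar \<nu> x \<eta> = f \<nu> (x, wbar) + \<eta> \<bullet> F \<nu> (block owner \<nu> x, wbar)"

text \<open>Row \<open>i\<close>, column \<open>j\<close> of the matrix lies in the block \<open>(owner i, owner j)\<close>; it is the derivative
  with respect to \<open>x\<^sub>j\<close> of the \<open>i\<close>-th entry of the gradient of \<open>l\<^sub>\<nu>\<close> in \<open>x\<^sup>\<nu>\<close>, where \<open>\<nu> = owner i\<close>.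
  Hence the rows belonging to different players come from different functions, and the matrix need
  not be symmetric.\<close>

definition game_hessian ::
    "('n::finite \<Rightarrow> 'p) \<Rightarrow> ('p \<Rightarrow> 'y::euclidean_space set)
     \<Rightarrow> ('p \<Rightarrow> (real^'n) \<times> 'd \<Rightarrow> real) \<Rightarrow> ('p \<Rightarrow> (real^'n) \<times> 'd \<Rightarrow> 'y)
     \<Rightarrow> 'd \<Rightarrow> real^'n \<Rightarrow> 'y \<Rightarrow> real^'n^'n" where
  "game_hessian owner Y f F wbar xbar ybar = (\<chi> i j.
     frechet_derivative
       (partial_gradient owner (owner i)
          (\<lambda>z. ref_lagrangian owner f F wbar (owner i) z (component (Y (owner i)) ybar)))
       (at xbar) (axis j 1) $ i)"

end

theory Submission
  imports Defs
begin

text \<open>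
  Near the reference point, \<open>S_Lag\<close> is the solution map of a generalized equation
  \<open>H (p, z) \<in> M z\<close>, where \<open>M\<close> is a product of normal cone mappings (hence has a closed graph), \<open>H\<close> is
  strictly differentiable, and the canonical perturbations \<open>(v, u)\<close> shift the value of \<open>H\<close>
  arbitrarily.  For such an equation with \<open>B\<close> the partial derivative of \<open>H\<close> in \<open>z\<close>, the Aubin property
  is equivalent to: \<open>B\<^sup>* \<zeta> \<in> D\<^sup>* M (\<zeta>)\<close> only for \<open>\<zeta> = 0\<close>.

  Necessity: testing a regular normal \<open>(a, b)\<close> to the graph of \<open>M\<close> along the solutions which the Aubin
  property provides for the perturbation in a direction \<open>e\<close> bounds \<open>\<langle>b, e\<rangle>\<close> by a
  multiple of \<open>\<parallel>a + B\<^sup>* b\<parallel>\<close> up to a vanishing error; pass to the limit along the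
  normals that define the coderivative and take \<open>e = -\<zeta>\<close>.
  Sufficiency: by compactness of the sphere, \<open>\<kappa> \<parallel>b\<parallel> \<le> \<parallel>a + B\<^sup>* b\<parallel>\<close> for all regular normals near the
  reference point.  Starting from a solution \<open>z\<close> for \<open>p\<close>, minimise over the graph of \<open>M\<close> the norm of the
  residual for \<open>p'\<close> plus a small quadratic penalty; Fermat's rule at a minimiser with nonzero
  residual would produce a regular normal violating this bound.

  The limiting normal cone of a product of subsets of orthogonal subspaces is the product of the
  limiting normal cones, which splits the condition on \<open>\<zeta> = (-w1, -w2)\<close> into the blocks.
\<close>

section \<open>Regular and limiting normals\<close>

text \<open>Working form of the Aubin property: both neighbourhoods shrink to balls of one common
  radius, and the inclusion becomes a pointwise estimate, since a scaled unit ball is the closed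
  ball of that radius. Radius \<open>0\<close>, which occurs for \<open>a' = a\<close>, is treated
  separately.\<close>

lemma aubin_property_iff:
  "aubin_property S abar bbar \<longleftrightarrow> bbar \<in> S abar \<and>
     (\<exists>\<delta>>0. \<exists>\<kappa>>0. \<forall>a\<in>ball abar \<delta>. \<forall>a'\<in>ball abar \<delta>. \<forall>b\<in>S a \<inter> ball bbar \<delta>.
        \<exists>b'\<in>S a'. norm (b - b') \<le> \<kappa> * norm (a' - a))" (is "_ \<longleftrightarrow> _ \<and> ?R")
proof -
  have mem: "b \<in> T + (\<lambda>b. c *\<^sub>R b) ` cball 0 1 \<longleftrightarrow> (\<exists>b'\<in>T. norm (b - b') \<le> c)"
    if "c \<ge> 0" for b :: 'b and T c
  proof
    assume "b \<in> T + (\<lambda>b. c *\<^sub>R b) ` cball 0 1"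
    then obtain b' e where "b' \<in> T" "norm e \<le> 1" "b = b' + c *\<^sub>R e"
      by (auto simp: set_plus_def)
    then show "\<exists>b'\<in>T. norm (b - b') \<le> c"
      using \<open>c \<ge> 0\<close> by (intro bexI[of _ b']) (auto simp: mult_left_le)
  next
    assume "\<exists>b'\<in>T. norm (b - b') \<le> c"
    then obtain b' where b': "b' \<in> T" "norm (b - b') \<le> c" by blast
    show "b \<in> T + (\<lambda>b. c *\<^sub>R b) ` cball 0 1"
    proof (cases "c = 0")
      case True
      then show ?thesis using b' by (auto simp: set_plus_def intro!: exI[of _ 0])
    next
      case False
      then have "c > 0" using \<open>c \<ge> 0\<close> by simp
      then have "norm (inverse c *\<^sub>R (b - b')) \<le> 1" "b = b' + c *\<^sub>R (inverse c *\<^sub>R (b - b'))"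
        using b' unfolding norm_scaleR by (auto simp: divide_simps)
      then have "c *\<^sub>R (inverse c *\<^sub>R (b - b')) \<in> (\<lambda>b. c *\<^sub>R b) ` cball 0 1"
        by (intro imageI) simp
      then show ?thesis
        using b'(1) \<open>b = _\<close> unfolding set_plus_def mem_Collect_eq by blast
    qed
  qed
  have dir1: "?R" if UV: "open U" "abar \<in> U" "open V" "bbar \<in> V" "\<kappa> > 0"
    "\<forall>a\<in>U. \<forall>a'\<in>U. S a \<inter> V \<subseteq> S a' + (\<lambda>b. (\<kappa> * norm (a' - a)) *\<^sub>R b) ` cball 0 1" for U V \<kappa>
  proof -
    obtain \<delta>1 \<delta>2 where d: "\<delta>1 > 0" "ball abar \<delta>1 \<subseteq> U" "\<delta>2 > 0" "ball bbar \<delta>2 \<subseteq> V"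
      using UV(1-4) open_contains_ball by meson
    have "min \<delta>1 \<delta>2 > 0" using d by simp
    have "\<exists>b'\<in>S a'. norm (b - b') \<le> \<kappa> * norm (a' - a)"
      if a: "a \<in> ball abar (min \<delta>1 \<delta>2)" "a' \<in> ball abar (min \<delta>1 \<delta>2)"
        "b \<in> S a \<inter> ball bbar (min \<delta>1 \<delta>2)" for a a' b
    proof -
      have "a \<in> U" "a' \<in> U" "b \<in> S a \<inter> V" using a d by auto
      then have "b \<in> S a' + (\<lambda>b. (\<kappa> * norm (a' - a)) *\<^sub>R b) ` cball 0 1"
        using UV(6) by blast
      then show ?thesis
        using \<open>\<kappa> > 0\<close> by (subst (asm) mem) auto
    qed
    then have "\<forall>a\<in>ball abar (min \<delta>1 \<delta>2). \<forall>a'\<in>ball abar (min \<delta>1 \<delta>2).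
        \<forall>b\<in>S a \<inter> ball bbar (min \<delta>1 \<delta>2). \<exists>b'\<in>S a'. norm (b - b') \<le> \<kappa> * norm (a' - a)"
      by (intro ballI)
    with \<open>min \<delta>1 \<delta>2 > 0\<close> \<open>\<kappa> > 0\<close> show ?R by (intro exI conjI)
  qed
  have dir2: "\<exists>U V \<kappa>. open U \<and> abar \<in> U \<and> open V \<and> bbar \<in> V \<and> \<kappa> > 0 \<and>
        (\<forall>a\<in>U. \<forall>a'\<in>U. S a \<inter> V \<subseteq> S a' + (\<lambda>b. (\<kappa> * norm (a' - a)) *\<^sub>R b) ` cball 0 1)" if R: ?R
  proof -
    obtain \<delta> \<kappa> where d: "\<delta> > 0" "\<kappa> > 0" "\<forall>a\<in>ball abar \<delta>. \<forall>a'\<in>ball abar \<delta>. \<forall>b\<in>S a \<inter> ball bbar \<delta>.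
        \<exists>b'\<in>S a'. norm (b - b') \<le> \<kappa> * norm (a' - a)" using R by blast
    show ?thesis
      by (rule exI[of _ "ball abar \<delta>"], rule exI[of _ "ball bbar \<delta>"], rule exI[of _ \<kappa>])
        (use d in \<open>auto simp: mem\<close>)
  qed
  show ?thesis unfolding aubin_property_def
    by (intro conj_cong refl iffI, elim exE conjE, rule dir1, assumption+, rule dir2)
qed

lemma limiting_normal_coneI:
  assumes "x \<in> C" "xs \<longlonglongrightarrow> x" "vs \<longlonglongrightarrow> v"
    "\<And>k. xs k \<in> C" "\<And>k. vs k \<in> regular_normal_cone E C (xs k)"
  shows "v \<in> limiting_normal_cone E C x"
  unfolding limiting_normal_cone_def using assms by auto

lemma limiting_normal_coneE:
  assumes "v \<in> limiting_normal_cone E C x"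
  obtains xs vs where "x \<in> C" "xs \<longlonglongrightarrow> x" "vs \<longlonglongrightarrow> v"
    "\<And>k. xs k \<in> C" "\<And>k. vs k \<in> regular_normal_cone E C (xs k)"
  using assms unfolding limiting_normal_cone_def by (auto split: if_splits)

lemma regular_normal_coneE:
  assumes "v \<in> regular_normal_cone E C x" "\<epsilon> > 0"
  obtains \<delta> where "\<delta> > 0" "\<And>z. z \<in> C \<Longrightarrow> dist z x < \<delta> \<Longrightarrow> v \<bullet> (z - x) \<le> \<epsilon> * norm (z - x)"
  using assms unfolding regular_normal_cone_def by (auto split: if_splits)

lemma regular_normal_cone_scaleR:
  assumes "subspace E" "v \<in> regular_normal_cone E C x" "t > 0"
  shows "t *\<^sub>R v \<in> regular_normal_cone E C x"
proof -
  have x: "x \<in> C" and v: "v \<in> E"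
    "\<And>\<epsilon>. \<epsilon> > 0 \<Longrightarrow> \<exists>\<delta>>0. \<forall>z\<in>C. dist z x < \<delta> \<longrightarrow> v \<bullet> (z - x) \<le> \<epsilon> * norm (z - x)"
    using assms(2) by (auto simp: regular_normal_cone_def split: if_splits)
  have "\<exists>\<delta>>0. \<forall>z\<in>C. dist z x < \<delta> \<longrightarrow> (t *\<^sub>R v) \<bullet> (z - x) \<le> \<epsilon> * norm (z - x)" if "\<epsilon> > 0" for \<epsilon>
  proof -
    obtain \<delta> where \<delta>: "\<delta> > 0" "\<And>z. z \<in> C \<Longrightarrow> dist z x < \<delta> \<Longrightarrow> v \<bullet> (z - x) \<le> \<epsilon> / t * norm (z - x)"
      using v(2)[of "\<epsilon> / t"] \<open>\<epsilon> > 0\<close> \<open>t > 0\<close> by auto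
    have "(t *\<^sub>R v) \<bullet> (z - x) \<le> \<epsilon> * norm (z - x)" if "z \<in> C" "dist z x < \<delta>" for z
      using mult_left_mono[OF \<delta>(2)[OF that], of t] \<open>t > 0\<close> by simp
    then show ?thesis using \<delta>(1) by blast
  qed
  then show ?thesis
    using x v(1) assms(1) by (simp add: regular_normal_cone_def subspace_scale)
qed

text \<open>At a local minimiser the first-order expansion of \<open>\<phi>\<close> leaves
  \<open>g \<bullet> (z - x)\<close> bounded below by \<open>- \<epsilon> * norm (z - x)\<close> on
  \<open>C\<close>, which is the defining inequality of a regular normal for
  \<open>- g\<close>.\<close>

lemma fermat_regular_normal:
  fixes C :: "'a::euclidean_space set"
  assumes "x \<in> C" "(\<phi> has_derivative (\<lambda>h. g \<bullet> h)) (at x)"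
    and "r > 0" and min: "\<And>z. z \<in> C \<Longrightarrow> dist z x < r \<Longrightarrow> \<phi> x \<le> \<phi> z"
  shows "- g \<in> regular_normal_cone UNIV C x"
proof -
  have "\<exists>\<delta>>0. \<forall>z\<in>C. dist z x < \<delta> \<longrightarrow> (- g) \<bullet> (z - x) \<le> \<epsilon> * norm (z - x)" if "\<epsilon> > 0" for \<epsilon>
  proof -
    obtain \<delta> where \<delta>: "\<delta> > 0"
      "\<And>z. norm (z - x) < \<delta> \<Longrightarrow> norm (\<phi> z - \<phi> x - g \<bullet> (z - x)) \<le> \<epsilon> * norm (z - x)"
      using assms(2) \<open>\<epsilon> > 0\<close> unfolding has_derivative_at_alt by blast
    have "(- g) \<bullet> (z - x) \<le> \<epsilon> * norm (z - x)" if "z \<in> C" "dist z x < min \<delta> r" for z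
      using \<delta>(2)[of z] min[of z] that by (auto simp: dist_norm abs_le_iff)
    then show ?thesis using \<delta>(1) \<open>r > 0\<close> by (intro exI[of _ "min \<delta> r"]) auto
  qed
  then show ?thesis using assms(1) by (simp add: regular_normal_cone_def)
qed

text \<open>Turns a kernel condition at the single point \<open>c\<close> into a uniform bound
  nearby. If every constant failed, the violating normals, scaled to \<open>norm b = 1\<close>,
  would cluster at some \<open>(- A \<beta>, \<beta>)\<close> with \<open>\<beta>\<close> on the
  unit sphere; this is a limiting normal excluded by \<open>inj\<close>.\<close>

lemma regular_normals_lower_bound:
  fixes C :: "('a::euclidean_space \<times> 'b::euclidean_space) set"
  assumes "c \<in> C" "bounded_linear A"
    and inj: "\<And>b. (- A b, b) \<in> limiting_normal_cone UNIV C c \<Longrightarrow> b = 0"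
  obtains \<kappa> r where "\<kappa> > 0" "r > 0"
    "\<And>c' a b. c' \<in> C \<Longrightarrow> dist c' c < r \<Longrightarrow> (a, b) \<in> regular_normal_cone UNIV C c' \<Longrightarrow>
       \<kappa> * norm b \<le> norm (a + A b)"
proof (rule ccontr)
  assume "\<not> thesis"
  then have no: "\<not> (\<kappa> > 0 \<and> r > 0 \<and> (\<forall>c' a b. c' \<in> C \<longrightarrow> dist c' c < r \<longrightarrow>
      (a, b) \<in> regular_normal_cone UNIV C c' \<longrightarrow> \<kappa> * norm b \<le> norm (a + A b)))" for \<kappa> r
    using that by blast
  have "\<exists>c' a b. c' \<in> C \<and> dist c' c < inverse (Suc k) \<and> (a, b) \<in> regular_normal_cone UNIV C c' \<and>
      norm (a + A b) < inverse (Suc k) * norm b" for k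
    using no[of "inverse (Suc k)" "inverse (Suc k)"] by (fastforce simp: not_le)
  then obtain cs as bs where seq: "\<And>k. cs k \<in> C" "\<And>k. dist (cs k) c < inverse (Suc k)"
    "\<And>k. (as k, bs k) \<in> regular_normal_cone UNIV C (cs k)"
    "\<And>k. norm (as k + A (bs k)) < inverse (Suc k) * norm (bs k)" by metis
  interpret A: bounded_linear A by fact
  have bs: "bs k \<noteq> 0" for k using seq(4)[of k] by auto
  \<comment> \<open>Only the second part is normalised, and compactness is applied to it alone. The
    first part then converges automatically, because \<open>a k + A (b k)\<close> tends to
    \<open>0\<close>.\<close>
  define b where "b k = inverse (norm (bs k)) *\<^sub>R bs k" for k
  define a where "a k = inverse (norm (bs k)) *\<^sub>R as k" for k
  have ab: "(a k, b k) \<in> regular_normal_cone UNIV C (cs k)" for k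
    using regular_normal_cone_scaleR[OF _ seq(3)[of k], of "inverse (norm (bs k))"] bs
    by (simp add: a_def b_def)
  have small: "norm (a k + A (b k)) < inverse (Suc k)" for k
  proof -
    have "a k + A (b k) = inverse (norm (bs k)) *\<^sub>R (as k + A (bs k))"
      by (simp add: a_def b_def A.scaleR scaleR_add_right)
    then have "norm (a k + A (b k)) = inverse (norm (bs k)) * norm (as k + A (bs k))" by simp
    then have "norm (bs k) * norm (a k + A (b k)) = norm (as k + A (bs k))"
      using bs[of k] by (simp add: field_simps)
    then have "norm (bs k) * norm (a k + A (b k)) < norm (bs k) * inverse (Suc k)"
      using seq(4)[of k] by (simp add: mult.commute)
    then show ?thesis by (rule mult_left_less_imp_less) simp
  qed
  have "\<forall>k. b k \<in> sphere 0 1" using bs by (simp add: b_def)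
  moreover have "compact (sphere (0::'b) 1)" by simp
  ultimately obtain \<beta> s where s: "\<beta> \<in> sphere 0 1" "strict_mono s" "(b \<circ> s) \<longlonglongrightarrow> \<beta>"
    unfolding compact_def by meson
  have inv0: "(\<lambda>k. inverse (real (Suc (s k)))) \<longlonglongrightarrow> 0"
    using LIMSEQ_subseq_LIMSEQ[OF LIMSEQ_inverse_real_of_nat s(2)] by (simp add: o_def)
  have "(\<lambda>k. a (s k) + A (b (s k))) \<longlonglongrightarrow> 0"
    by (rule Lim_null_comparison[OF _ inv0]) (intro always_eventually allI less_imp_le[OF small])
  moreover have "(\<lambda>k. A (b (s k))) \<longlonglongrightarrow> A \<beta>" using A.tendsto[OF s(3)] by (simp add: o_def)
  ultimately have "(\<lambda>k. a (s k)) \<longlonglongrightarrow> - A \<beta>" using tendsto_diff by fastforce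
  then have "(\<lambda>k. (a (s k), b (s k))) \<longlonglongrightarrow> (- A \<beta>, \<beta>)"
    using s(3) by (auto intro!: tendsto_Pair simp: o_def)
  moreover have "(\<lambda>k. cs (s k)) \<longlonglongrightarrow> c"
    unfolding tendsto_dist_iff[of _ c]
    by (rule Lim_null_comparison[OF _ inv0]) (use less_imp_le[OF seq(2)] in \<open>simp add: always_eventually\<close>)
  ultimately have "(- A \<beta>, \<beta>) \<in> limiting_normal_cone UNIV C c"
    using \<open>c \<in> C\<close> seq(1) ab by (intro limiting_normal_coneI)
  then show False using inj s(1) by force
qed

text \<open>A Lipschitz estimate centred at \<open>x\<close> passes to difference quotients and
  hence to the derivative. It is applied to the difference between \<open>H (p', _)\<close> and its
  approximation \<open>B\<close>, to see that their derivatives are close.\<close>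

lemma has_derivative_norm_le:
  fixes \<phi> :: "'a::real_normed_vector \<Rightarrow> 'b::real_normed_vector"
  assumes "(\<phi> has_derivative \<phi>') (at x)" "\<delta> > 0"
    and lip: "\<And>y. norm (y - x) < \<delta> \<Longrightarrow> norm (\<phi> y - \<phi> x) \<le> \<epsilon> * norm (y - x)"
  shows "norm (\<phi>' h) \<le> \<epsilon> * norm h"
proof (cases "h = 0")
  case True
  then show ?thesis using has_derivative_bounded_linear[OF assms(1)]
    by (simp add: linear_simps)
next
  case False
  interpret bounded_linear \<phi>' using has_derivative_bounded_linear[OF assms(1)] .
  have "norm (\<phi>' h) \<le> (\<epsilon> * norm h) + e" if "e > 0" for e
  proof -
    define e' where "e' = e / norm h"
    have "e' > 0" using that False by (simp add: e'_def)
    then obtain d where d: "d > 0"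
      "\<And>y. norm (y - x) < d \<Longrightarrow> norm (\<phi> y - \<phi> x - \<phi>' (y - x)) \<le> e' * norm (y - x)"
      using assms(1) unfolding has_derivative_at_alt by blast
    \<comment> \<open>Half of the smaller radius, so that \<open>x + t *\<^sub>R h\<close> lies
      strictly inside both balls.\<close>
    define t where "t = min d \<delta> / (2 * norm h)"
    have t: "t > 0" "t * norm h < d" "t * norm h < \<delta>"
      using d(1) \<open>\<delta> > 0\<close> False by (auto simp: t_def)
    have "norm (\<phi>' (t *\<^sub>R h)) \<le> \<epsilon> * norm (t *\<^sub>R h) + e' * norm (t *\<^sub>R h)"
      using d(2)[of "x + t *\<^sub>R h"] lip[of "x + t *\<^sub>R h"] t
        norm_triangle_sub[of "\<phi>' (t *\<^sub>R h)" "\<phi> (x + t *\<^sub>R h) - \<phi> x"]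
      by (simp add: norm_minus_commute)
    then have "t * norm (\<phi>' h) \<le> t * ((\<epsilon> + e') * norm h)"
      using t(1) by (simp add: scaleR algebra_simps)
    then have "norm (\<phi>' h) \<le> (\<epsilon> + e') * norm h" using t(1) by simp
    then show ?thesis using False by (simp add: e'_def algebra_simps)
  qed
  then show ?thesis by (rule field_le_epsilon)
qed

section \<open>Strict differentiability\<close>

text \<open>Fixing the second point at \<open>z\<close> in the two-point estimate gives the ordinary
  derivative, so \<open>D\<close> is determined by \<open>h\<close>.\<close>

lemma strictly_differentiable_atE:
  assumes "strictly_differentiable_at h z"
  obtains D where "(h has_derivative D) (at z)"
    "\<forall>\<epsilon>>0. \<exists>\<delta>>0. \<forall>a\<in>ball z \<delta>. \<forall>b\<in>ball z \<delta>. norm (h a - h b - D (a - b)) \<le> \<epsilon> * norm (a - b)"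
proof -
  obtain D where D: "bounded_linear D"
    "\<forall>\<epsilon>>0. \<exists>\<delta>>0. \<forall>a\<in>ball z \<delta>. \<forall>b\<in>ball z \<delta>. norm (h a - h b - D (a - b)) \<le> \<epsilon> * norm (a - b)"
    using assms unfolding strictly_differentiable_at_def by blast
  have "(h has_derivative D) (at z)"
    unfolding has_derivative_at_alt
  proof (intro conjI D(1) allI impI)
    fix \<epsilon> :: real assume "\<epsilon> > 0"
    then obtain \<delta> where "\<delta> > 0"
      "\<forall>a\<in>ball z \<delta>. \<forall>b\<in>ball z \<delta>. norm (h a - h b - D (a - b)) \<le> \<epsilon> * norm (a - b)"
      using D(2) by blast
    then show "\<exists>d>0. \<forall>y. norm (y - z) < d \<longrightarrow> norm (h y - h z - D (y - z)) \<le> \<epsilon> * norm (y - z)"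
      by (intro exI[of _ \<delta>]) (auto simp: dist_norm norm_minus_commute)
  qed
  then show thesis using that D(2) by blast
qed

lemma strictly_differentiable_imp_differentiable:
  "strictly_differentiable_at h z \<Longrightarrow> h differentiable (at z)"
  unfolding differentiable_def by (erule strictly_differentiable_atE) (rule exI)

text \<open>Tolerance \<open>1\<close> in the two-point estimate already suffices: the modulus is a
  bound of \<open>D\<close> plus \<open>1\<close>.\<close>

lemma strictly_differentiable_lipschitz:
  assumes "strictly_differentiable_at h z"
  obtains L \<delta> where "L > 0" "\<delta> > 0"
    "\<And>a b. a \<in> ball z \<delta> \<Longrightarrow> b \<in> ball z \<delta> \<Longrightarrow> norm (h a - h b) \<le> L * norm (a - b)"
proof -
  obtain D where D: "(h has_derivative D) (at z)"
    "\<forall>\<epsilon>>0. \<exists>\<delta>>0. \<forall>a\<in>ball z \<delta>. \<forall>b\<in>ball z \<delta>. norm (h a - h b - D (a - b)) \<le> \<epsilon> * norm (a - b)"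
    by (rule strictly_differentiable_atE[OF assms]) (rule that)
  obtain K where K: "K > 0" "\<And>x. norm (D x) \<le> norm x * K"
    using bounded_linear.pos_bounded[OF has_derivative_bounded_linear[OF D(1)]] by blast
  obtain \<delta> where \<delta>: "\<delta> > 0"
    "\<And>a b. a \<in> ball z \<delta> \<Longrightarrow> b \<in> ball z \<delta> \<Longrightarrow> norm (h a - h b - D (a - b)) \<le> 1 * norm (a - b)"
    using D(2)[rule_format, of 1] by auto
  have "norm (h a - h b) \<le> (K + 1) * norm (a - b)" if "a \<in> ball z \<delta>" "b \<in> ball z \<delta>" for a b
    using \<delta>(2)[OF that] K(2)[of "a - b"] norm_triangle_sub[of "h a - h b" "D (a - b)"]
    by (simp add: algebra_simps)
  then show thesis using that[of "K + 1" \<delta>] K(1) \<delta>(1) by auto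
qed

lemma strictly_differentiable_linear:
  assumes "bounded_linear h"
  shows "strictly_differentiable_at h z"
  unfolding strictly_differentiable_at_def
proof (intro exI[of _ h] conjI assms allI impI)
  interpret bounded_linear h by fact
  show "\<exists>\<delta>>0. \<forall>a\<in>ball z \<delta>. \<forall>b\<in>ball z \<delta>. norm (h a - h b - h (a - b)) \<le> \<epsilon> * norm (a - b)"
    if "\<epsilon> > 0" for \<epsilon> :: real
    using that by (auto simp: diff intro: exI[of _ 1])
qed

lemma strictly_differentiable_compose:
  assumes "strictly_differentiable_at h z" "strictly_differentiable_at k (h z)"
  shows "strictly_differentiable_at (\<lambda>x. k (h x)) z"
proof -
  obtain D where D: "(h has_derivative D) (at z)"
    "\<forall>\<epsilon>>0. \<exists>\<delta>>0. \<forall>a\<in>ball z \<delta>. \<forall>b\<in>ball z \<delta>. norm (h a - h b - D (a - b)) \<le> \<epsilon> * norm (a - b)"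
    by (rule strictly_differentiable_atE[OF assms(1)]) (rule that)
  obtain D' where D': "(k has_derivative D') (at (h z))"
    "\<forall>\<epsilon>>0. \<exists>\<delta>>0. \<forall>a\<in>ball (h z) \<delta>. \<forall>b\<in>ball (h z) \<delta>. norm (k a - k b - D' (a - b)) \<le> \<epsilon> * norm (a - b)"
    by (rule strictly_differentiable_atE[OF assms(2)]) (rule that)
  interpret D': bounded_linear D' using D'(1) by (rule has_derivative_bounded_linear)
  obtain K where K: "K > 0" "\<And>x. norm (D' x) \<le> norm x * K"
    using D'.pos_bounded by blast
  obtain L \<delta>0 where L: "L > 0" "\<delta>0 > 0"
    "\<And>a b. a \<in> ball z \<delta>0 \<Longrightarrow> b \<in> ball z \<delta>0 \<Longrightarrow> norm (h a - h b) \<le> L * norm (a - b)"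
    by (rule strictly_differentiable_lipschitz[OF assms(1)]) (rule that)
  show ?thesis
    unfolding strictly_differentiable_at_def
  proof (intro exI[of _ "\<lambda>x. D' (D x)"] conjI allI impI)
    show "bounded_linear (\<lambda>x. D' (D x))"
      by (rule bounded_linear_compose[OF D'.bounded_linear_axioms has_derivative_bounded_linear[OF D(1)]])
    fix \<epsilon> :: real assume "\<epsilon> > 0"
    obtain \<delta>1 where \<delta>1: "\<delta>1 > 0" "\<And>a b. a \<in> ball z \<delta>1 \<Longrightarrow> b \<in> ball z \<delta>1 \<Longrightarrow>
        norm (h a - h b - D (a - b)) \<le> \<epsilon> / (2 * K) * norm (a - b)"
      using D(2)[rule_format, of "\<epsilon> / (2 * K)"] \<open>\<epsilon> > 0\<close> K(1) by auto
    obtain \<delta>2 where \<delta>2: "\<delta>2 > 0" "\<And>a b. a \<in> ball (h z) \<delta>2 \<Longrightarrow> b \<in> ball (h z) \<delta>2 \<Longrightarrow>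
        norm (k a - k b - D' (a - b)) \<le> \<epsilon> / (2 * L) * norm (a - b)"
      using D'(2)[rule_format, of "\<epsilon> / (2 * L)"] \<open>\<epsilon> > 0\<close> L(1) by auto
    \<comment> \<open>The bound \<open>\<delta>2 / L\<close> makes \<open>h\<close> map the ball
      into the region where \<open>k\<close> is controlled. The tolerances
      \<open>\<epsilon> / (2 * K)\<close> and \<open>\<epsilon> / (2 * L)\<close> make the inner and
      outer errors contribute \<open>\<epsilon> / 2\<close> each.\<close>
    define \<delta> where "\<delta> = min (min \<delta>0 \<delta>1) (\<delta>2 / L)"
    have near: "h a \<in> ball (h z) \<delta>2" if "a \<in> ball z \<delta>" for a
    proof -
      have "L * norm (z - a) < \<delta>2" using that L(1) by (simp add: \<delta>_def dist_norm field_simps)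
      then show ?thesis using L(3)[of z a] that L(2) by (auto simp: \<delta>_def dist_norm)
    qed
    have "norm (k (h a) - k (h b) - D' (D (a - b))) \<le> \<epsilon> * norm (a - b)"
      if ab: "a \<in> ball z \<delta>" "b \<in> ball z \<delta>" for a b
    proof -
      have "norm (k (h a) - k (h b) - D' (h a - h b)) \<le> \<epsilon> / (2 * L) * norm (h a - h b)"
        using \<delta>2(2) near ab by blast
      also have "\<dots> \<le> \<epsilon> / (2 * L) * (L * norm (a - b))"
        using L ab \<open>\<epsilon> > 0\<close> by (intro mult_left_mono) (auto simp: \<delta>_def)
      finally have 1: "norm (k (h a) - k (h b) - D' (h a - h b)) \<le> \<epsilon> / 2 * norm (a - b)"
        using L(1) by simp
      have "norm (D' (h a - h b - D (a - b))) \<le> norm (h a - h b - D (a - b)) * K" by (rule K)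
      also have "\<dots> \<le> (\<epsilon> / (2 * K) * norm (a - b)) * K"
        using \<delta>1(2)[of a b] ab K(1) by (intro mult_right_mono) (auto simp: \<delta>_def)
      finally have 2: "norm (D' (h a - h b - D (a - b))) \<le> \<epsilon> / 2 * norm (a - b)"
        using K(1) by simp
      have "k (h a) - k (h b) - D' (D (a - b))
          = (k (h a) - k (h b) - D' (h a - h b)) + D' (h a - h b - D (a - b))"
        by (simp add: D'.diff)
      also have "norm \<dots> \<le> \<epsilon> / 2 * norm (a - b) + \<epsilon> / 2 * norm (a - b)"
        by (rule norm_triangle_mono[OF 1 2])
      finally show ?thesis by simp
    qed
    moreover have "\<delta> > 0" using \<delta>1 \<delta>2 L by (simp add: \<delta>_def)
    ultimately show "\<exists>\<delta>>0. \<forall>a\<in>ball z \<delta>. \<forall>b\<in>ball z \<delta>.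
        norm (k (h a) - k (h b) - D' (D (a - b))) \<le> \<epsilon> * norm (a - b)" by blast
  qed
qed

lemma strictly_differentiable_Pair:
  assumes "strictly_differentiable_at h z" "strictly_differentiable_at k z"
  shows "strictly_differentiable_at (\<lambda>x. (h x, k x)) z"
proof -
  obtain D where D: "(h has_derivative D) (at z)"
    "\<forall>\<epsilon>>0. \<exists>\<delta>>0. \<forall>a\<in>ball z \<delta>. \<forall>b\<in>ball z \<delta>. norm (h a - h b - D (a - b)) \<le> \<epsilon> * norm (a - b)"
    by (rule strictly_differentiable_atE[OF assms(1)]) (rule that)
  obtain D' where D': "(k has_derivative D') (at z)"
    "\<forall>\<epsilon>>0. \<exists>\<delta>>0. \<forall>a\<in>ball z \<delta>. \<forall>b\<in>ball z \<delta>. norm (k a - k b - D' (a - b)) \<le> \<epsilon> * norm (a - b)"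
    by (rule strictly_differentiable_atE[OF assms(2)]) (rule that)
  show ?thesis
    unfolding strictly_differentiable_at_def
  proof (intro exI[of _ "\<lambda>x. (D x, D' x)"] conjI allI impI)
    show "bounded_linear (\<lambda>x. (D x, D' x))"
      using D(1) D'(1) by (intro bounded_linear_Pair has_derivative_bounded_linear)
    fix \<epsilon> :: real assume "\<epsilon> > 0"
    obtain \<delta>1 where \<delta>1: "\<delta>1 > 0" "\<And>a b. a \<in> ball z \<delta>1 \<Longrightarrow> b \<in> ball z \<delta>1 \<Longrightarrow>
        norm (h a - h b - D (a - b)) \<le> \<epsilon> / 2 * norm (a - b)"
      using D(2)[rule_format, of "\<epsilon> / 2"] \<open>\<epsilon> > 0\<close> by auto
    obtain \<delta>2 where \<delta>2: "\<delta>2 > 0" "\<And>a b. a \<in> ball z \<delta>2 \<Longrightarrow> b \<in> ball z \<delta>2 \<Longrightarrow>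
        norm (k a - k b - D' (a - b)) \<le> \<epsilon> / 2 * norm (a - b)"
      using D'(2)[rule_format, of "\<epsilon> / 2"] \<open>\<epsilon> > 0\<close> by auto
    have "norm ((h a, k a) - (h b, k b) - (D (a - b), D' (a - b))) \<le> \<epsilon> * norm (a - b)"
      if "a \<in> ball z (min \<delta>1 \<delta>2)" "b \<in> ball z (min \<delta>1 \<delta>2)" for a b
      using \<delta>1(2)[of a b] \<delta>2(2)[of a b] that
        norm_Pair_le[of "h a - h b - D (a - b)" "k a - k b - D' (a - b)"] by auto
    then show "\<exists>\<delta>>0. \<forall>a\<in>ball z \<delta>. \<forall>b\<in>ball z \<delta>.
        norm ((h a, k a) - (h b, k b) - (D (a - b), D' (a - b))) \<le> \<epsilon> * norm (a - b)"
      using \<delta>1(1) \<delta>2(1) by (intro exI[of _ "min \<delta>1 \<delta>2"]) auto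
  qed
qed

lemma strictly_differentiable_bilinear:
  assumes "bounded_bilinear p"
  shows "strictly_differentiable_at (\<lambda>(x, y). p x y) z"
proof -
  interpret p: bounded_bilinear p by fact
  obtain x0 y0 where z: "z = (x0, y0)" by (cases z)
  obtain K where K: "K > 0" "\<And>x y. norm (p x y) \<le> norm x * norm y * K"
    using p.pos_bounded by blast
  show ?thesis
    unfolding strictly_differentiable_at_def
  proof (intro exI[of _ "\<lambda>h. p (fst h) y0 + p x0 (snd h)"] conjI allI impI)
    show "bounded_linear (\<lambda>h. p (fst h) y0 + p x0 (snd h))"
      by (intro bounded_linear_add bounded_linear_compose[OF p.bounded_linear_left]
          bounded_linear_compose[OF p.bounded_linear_right] bounded_linear_fst bounded_linear_snd)
    fix \<epsilon> :: real assume "\<epsilon> > 0"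
    define \<delta> where "\<delta> = \<epsilon> / (2 * K)"
    have "norm ((case a of (x, y) \<Rightarrow> p x y) - (case b of (x, y) \<Rightarrow> p x y)
        - (p (fst (a - b)) y0 + p x0 (snd (a - b)))) \<le> \<epsilon> * norm (a - b)"
      if "a \<in> ball z \<delta>" "b \<in> ball z \<delta>" for a b
    proof -
      obtain x y x' y' where ab: "a = (x, y)" "b = (x', y')" by (cases a, cases b)
      have d: "norm (y - y0) \<le> \<delta>" "norm (x' - x0) \<le> \<delta>"
        "norm (x - x') \<le> norm (a - b)" "norm (y - y') \<le> norm (a - b)"
        using norm_snd_le[of "y0 - y" "x0 - x"] norm_fst_le[of "x0 - x'" "y0 - y'"]
          norm_snd_le[of "y - y'" "x - x'"] norm_fst_le[of "x - x'" "y - y'"] that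
          norm_minus_commute[of y y0] norm_minus_commute[of x' x0]
        by (auto simp: z ab dist_norm)
      \<comment> \<open>An exact identity: each remainder term contains one factor measured from the
        base point, at most \<open>\<delta>\<close>, and one increment. Two such terms explain the
        choice \<open>\<epsilon> / (2 * K)\<close> for \<open>\<delta>\<close>.\<close>
      have "p x y - p x' y' - (p (x - x') y0 + p x0 (y - y')) = p (x - x') (y - y0) + p (x' - x0) (y - y')"
        by (simp add: p.diff_left p.diff_right algebra_simps)
      also have "norm \<dots> \<le> norm (x - x') * norm (y - y0) * K + norm (x' - x0) * norm (y - y') * K"
        by (rule norm_triangle_mono[OF K(2) K(2)])
      also have "\<dots> \<le> norm (a - b) * \<delta> * K + \<delta> * norm (a - b) * K"
        using d K(1) by (intro add_mono mult_right_mono mult_mono) (auto intro: order_trans[OF norm_ge_zero])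
      also have "\<dots> = \<epsilon> * norm (a - b)" using K(1) by (simp add: \<delta>_def field_simps)
      finally show ?thesis by (simp add: ab)
    qed
    moreover have "\<delta> > 0" using \<open>\<epsilon> > 0\<close> K(1) by (simp add: \<delta>_def)
    ultimately show "\<exists>\<delta>>0. \<forall>a\<in>ball z \<delta>. \<forall>b\<in>ball z \<delta>.
        norm ((case a of (x, y) \<Rightarrow> p x y) - (case b of (x, y) \<Rightarrow> p x y)
          - (p (fst (a - b)) y0 + p x0 (snd (a - b)))) \<le> \<epsilon> * norm (a - b)" by blast
  qed
qed

lemma strictly_differentiable_linear_compose:
  assumes "bounded_linear A" "strictly_differentiable_at h z"
  shows "strictly_differentiable_at (\<lambda>x. A (h x)) z"
  by (rule strictly_differentiable_compose[OF assms(2) strictly_differentiable_linear[OF assms(1)]])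

lemma strictly_differentiable_add:
  assumes "strictly_differentiable_at h z" "strictly_differentiable_at k z"
  shows "strictly_differentiable_at (\<lambda>x. h x + k x) z"
proof -
  have "strictly_differentiable_at (\<lambda>x. (\<lambda>p. fst p + snd p) (h x, k x)) z"
    by (rule strictly_differentiable_linear_compose[OF _ strictly_differentiable_Pair[OF assms]])
      (intro bounded_linear_add bounded_linear_fst bounded_linear_snd)
  then show ?thesis by simp
qed

lemma strictly_differentiable_diff:
  assumes "strictly_differentiable_at h z" "strictly_differentiable_at k z"
  shows "strictly_differentiable_at (\<lambda>x. h x - k x) z"
  using strictly_differentiable_add[OF assms(1)
      strictly_differentiable_linear_compose[OF bounded_linear_minus[OF bounded_linear_ident] assms(2)]]
  by simp

lemma strictly_differentiable_sum:
  assumes "finite I" "\<And>i. i \<in> I \<Longrightarrow> strictly_differentiable_at (h i) z"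
  shows "strictly_differentiable_at (\<lambda>x. \<Sum>i\<in>I. h i x) z"
  using assms
proof (induction I rule: finite_induct)
  case empty
  show ?case using strictly_differentiable_linear[OF bounded_linear_zero] by simp
next
  case (insert i I)
  then show ?case by (simp add: strictly_differentiable_add)
qed

text \<open>Makes the multiplier term of the Lagrangian gradient a bilinear function of the pair
  (derivative of the constraint, multiplier), so that its strict differentiability follows from that
  of the two entries. Identities are checked by testing with inner products; the bound comes from
  inserting the adjoint's own value.\<close>

lemma bounded_bilinear_adjoint:
  "bounded_bilinear (\<lambda>(D :: 'a::euclidean_space \<Rightarrow>\<^sub>L 'b::euclidean_space) y. adjoint (blinfun_apply D) y)"
proof -
  have lin: "linear (blinfun_apply D)" for D :: "'a \<Rightarrow>\<^sub>L 'b"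
    by (simp add: blinfun.bounded_linear_right bounded_linear.linear)
  have adj: "x \<bullet> adjoint (blinfun_apply D) y = blinfun_apply D x \<bullet> y" for D :: "'a \<Rightarrow>\<^sub>L 'b" and x y
    by (rule adjoint_works[OF lin])
  have eqI: "u = v" if "\<And>x. x \<bullet> u = x \<bullet> v" for u v :: 'a
    using that vector_eq_ldot by blast
  have bound: "norm (adjoint (blinfun_apply D) y) \<le> norm D * norm y" for D :: "'a \<Rightarrow>\<^sub>L 'b" and y
  proof (cases "adjoint (blinfun_apply D) y = 0")
    case False
    let ?a = "adjoint (blinfun_apply D) y"
    have "norm ?a * norm ?a = ?a \<bullet> ?a" by (simp add: norm_eq_sqrt_inner)
    also have "\<dots> = blinfun_apply D ?a \<bullet> y" by (rule adj)
    also have "\<dots> \<le> norm (blinfun_apply D ?a) * norm y" by (rule norm_cauchy_schwarz)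
    also have "\<dots> \<le> (norm D * norm ?a) * norm y" by (intro mult_right_mono norm_blinfun) simp
    also have "\<dots> = (norm D * norm y) * norm ?a" by (simp only: mult_ac)
    finally show ?thesis using False by (meson mult_le_cancel_right_pos zero_less_norm_iff)
  next
    case True
    then show ?thesis by simp
  qed
  show ?thesis
  proof (unfold_locales, goal_cases)
    case (1 D D' y)
    show ?case by (rule eqI) (simp add: adj inner_add blinfun.add_left)
  next
    case (2 D y y')
    show ?case by (rule eqI) (simp add: adj inner_add)
  next
    case (3 r D y)
    show ?case by (rule eqI) (simp add: adj blinfun.scaleR_left)
  next
    case (4 D r y)
    show ?case by (rule eqI) (simp add: adj)
  next
    case 5
    show ?case using bound by (intro exI[of _ 1]) simp
  qed
qed

section \<open>The Aubin property of a generalized equation\<close>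

text \<open>The parameter enters only through \<open>H\<close>, so \<open>M\<close> has a fixed
  graph whose normals can be studied. \<open>B\<close> is tied to the reference point, whereas
  smoothness is assumed throughout \<open>W\<close>, because Fermat's rule is applied at points
  other than \<open>zbar\<close>.\<close>

locale generalized_equation =
  fixes H :: "'q::real_normed_vector \<times> 'z::euclidean_space \<Rightarrow> 'z" and M :: "'z \<Rightarrow> 'z set"
    and S :: "'q \<Rightarrow> 'z set" and pbar :: 'q and zbar :: 'z and B :: "'z \<Rightarrow> 'z"
    and W :: "('q \<times> 'z) set"
  assumes closed: "closed (gph M)"
    and W: "open W" "(pbar, zbar) \<in> W"
    and S_iff: "\<And>p z. (p, z) \<in> W \<Longrightarrow> z \<in> S p \<longleftrightarrow> H (p, z) \<in> M z"
    and smooth: "\<And>p z. (p, z) \<in> W \<Longrightarrow> strictly_differentiable_at H (p, z)"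
    and sol: "zbar \<in> S pbar"
    and B: "((\<lambda>z. H (pbar, z)) has_derivative B) (at zbar)"
begin

lemma B_linear: "bounded_linear B"
  using B by (rule has_derivative_bounded_linear)

lemma inner_adjoint_B: "x \<bullet> adjoint B y = B x \<bullet> y" "adjoint B y \<bullet> x = y \<bullet> B x"
  using adjoint_works[of B x y] B_linear bounded_linear.linear by (auto simp: inner_commute)

text \<open>Two points with the same \<open>p\<close> differ by \<open>(0, z - z')\<close>, so the
  strict derivative acts on them through \<open>B\<close> alone. This makes the approximation by
  \<open>B\<close> uniform in \<open>p\<close> as well as in \<open>z\<close>.\<close>

lemma partial_strict:
  assumes "\<epsilon> > 0"
  obtains \<delta> where "\<delta> > 0" "\<And>p. p \<in> ball pbar \<delta> \<Longrightarrow> ball zbar \<delta> \<subseteq> {z. (p, z) \<in> W}"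
    "\<And>p z z'. p \<in> ball pbar \<delta> \<Longrightarrow> z \<in> ball zbar \<delta> \<Longrightarrow> z' \<in> ball zbar \<delta> \<Longrightarrow>
       norm (H (p, z) - H (p, z') - B (z - z')) \<le> \<epsilon> * norm (z - z')"
proof -
  obtain D where D: "(H has_derivative D) (at (pbar, zbar))"
    "\<forall>\<epsilon>>0. \<exists>\<delta>>0. \<forall>a\<in>ball (pbar, zbar) \<delta>. \<forall>b\<in>ball (pbar, zbar) \<delta>.
       norm (H a - H b - D (a - b)) \<le> \<epsilon> * norm (a - b)"
    by (rule strictly_differentiable_atE[OF smooth[OF W(2)]]) (rule that)
  have "((\<lambda>z. (pbar, z)) has_derivative (\<lambda>h. (0, h))) (at zbar)"
    by (auto intro!: derivative_eq_intros)
  from has_derivative_compose[OF this D(1)]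
  have "((\<lambda>z. H (pbar, z)) has_derivative (\<lambda>h. D (0, h))) (at zbar)" by simp
  then have DB: "D (0, h) = B h" for h
    using has_derivative_unique[OF B] by metis
  obtain \<delta>1 where \<delta>1: "\<delta>1 > 0" "\<And>a b. a \<in> ball (pbar, zbar) \<delta>1 \<Longrightarrow> b \<in> ball (pbar, zbar) \<delta>1 \<Longrightarrow>
       norm (H a - H b - D (a - b)) \<le> \<epsilon> * norm (a - b)"
    using D(2) assms by meson
  obtain \<delta>2 where \<delta>2: "\<delta>2 > 0" "ball (pbar, zbar) \<delta>2 \<subseteq> W"
    using W open_contains_ball by meson
  \<comment> \<open>The distance in the product is at most the sum of the two distances, hence the
    factor \<open>2\<close>.\<close>
  define \<delta> where "\<delta> = min \<delta>1 \<delta>2 / 2"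
  have near: "(p, z) \<in> ball (pbar, zbar) \<delta>1 \<inter> ball (pbar, zbar) \<delta>2"
    if "p \<in> ball pbar \<delta>" "z \<in> ball zbar \<delta>" for p z
  proof -
    have "dist (pbar, zbar) (p, z) \<le> dist pbar p + dist zbar z"
      using norm_Pair_le[of "pbar - p" "zbar - z"] by (simp add: dist_norm)
    also have "\<dots> < min \<delta>1 \<delta>2" using that by (simp add: \<delta>_def)
    finally show ?thesis by simp
  qed
  show thesis
  proof (rule that)
    show "\<delta> > 0" using \<delta>1 \<delta>2 by (simp add: \<delta>_def)
    show "ball zbar \<delta> \<subseteq> {z. (p, z) \<in> W}" if "p \<in> ball pbar \<delta>" for p
      using near[OF that] \<delta>2(2) by blast
    show "norm (H (p, z) - H (p, z') - B (z - z')) \<le> \<epsilon> * norm (z - z')"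
      if "p \<in> ball pbar \<delta>" "z \<in> ball zbar \<delta>" "z' \<in> ball zbar \<delta>" for p z z'
      using \<delta>1(2)[of "(p, z)" "(p, z')"] near[OF that(1,2)] near[OF that(1,3)] DB by simp
  qed
qed

text \<open>Moving the parameter by \<open>j (t *\<^sub>R e)\<close> yields a solution at distance
  of order \<open>t\<close>. Testing the normal on the resulting graph point, whose second part
  changes by \<open>t *\<^sub>R e + B \<Delta> + err\<close>, and dividing by \<open>t\<close>
  isolates \<open>b \<bullet> e\<close>. The extra \<epsilon> absorbs the error allowed by the
  regular normal.\<close>

lemma regular_normal_estimate:
  assumes j: "bounded_linear j" "\<And>p e z. H (p + j e, z) = H (p, z) + e"
    and J: "J \<ge> 0" "\<And>e. norm (j e) \<le> norm e * J"
    and aubin: "\<kappa> > 0" "\<And>p p' z. p \<in> ball pbar \<delta> \<Longrightarrow> p' \<in> ball pbar \<delta> \<Longrightarrow> z \<in> S p \<inter> ball zbar \<delta> \<Longrightarrow>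
       \<exists>z'\<in>S p'. norm (z - z') \<le> \<kappa> * norm (p' - p)"
    and W': "\<And>p. p \<in> ball pbar \<delta> \<Longrightarrow> ball zbar \<delta> \<subseteq> {z. (p, z) \<in> W}"
    and strict: "\<And>p z z'. p \<in> ball pbar \<delta> \<Longrightarrow> z \<in> ball zbar \<delta> \<Longrightarrow> z' \<in> ball zbar \<delta> \<Longrightarrow>
       norm (H (p, z) - H (p, z') - B (z - z')) \<le> \<eta> * norm (z - z')"
    and \<eta>: "\<eta> \<ge> 0"
    and p: "p \<in> ball pbar \<delta>" and z: "z \<in> ball zbar \<delta>" and graph: "(z, H (p, z)) \<in> gph M"
    and ab: "(a, b) \<in> regular_normal_cone UNIV (gph M) (z, H (p, z))"
  shows "b \<bullet> e \<le> \<kappa> * J * norm e * (norm (a + adjoint B b) + \<eta> * norm b)"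
proof (rule field_le_epsilon)
  fix \<epsilon> :: real assume "\<epsilon> > 0"
  interpret B: bounded_linear B by (rule B_linear)
  interpret j: bounded_linear j by (rule j(1))
  obtain \<beta> where \<beta>: "\<beta> > 0" "\<And>x. norm (B x) \<le> norm x * \<beta>" using B.pos_bounded by blast
  define R where "R = \<kappa> * J * norm e"
  \<comment> \<open>Per unit of \<open>t\<close>, \<open>C\<close> dominates the parameter step, the
    solution step and the displacement in the graph. The summand \<open>1\<close> keeps it positive
    even for \<open>e = 0\<close>.\<close>
  define C where "C = 1 + J * norm e + norm e + (2 + \<beta> + \<eta>) * R"
  have R: "R \<ge> 0" using aubin(1) J(1) by (simp add: R_def)
  have Je: "0 \<le> J * norm e" using J(1) by simp
  have bR: "0 \<le> (\<beta> + \<eta>) * R" using \<beta>(1) \<eta> R by simp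
  have C: "C > 0" "J * norm e \<le> C" "R \<le> C" "norm e + (1 + \<beta> + \<eta>) * R \<le> C"
    using R Je bR by (auto simp: C_def algebra_simps add_nonneg_nonneg add_pos_nonneg)
  obtain d where d: "d > 0" "\<And>c. c \<in> gph M \<Longrightarrow> dist c (z, H (p, z)) < d \<Longrightarrow>
      (a, b) \<bullet> (c - (z, H (p, z))) \<le> \<epsilon> / C * norm (c - (z, H (p, z)))"
    using regular_normal_coneE[OF ab, of "\<epsilon> / C"] \<open>\<epsilon> > 0\<close> C(1) by (metis divide_pos_pos)
  \<comment> \<open>Steps below \<open>r\<close> keep \<open>p'\<close> and \<open>z'\<close> in the
    balls of radius \<open>\<delta>\<close> and the graph point in the range of the regular normal
    inequality. The choice of \<open>t\<close> gives \<open>t * C = r / 2\<close>, so all strict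
    bounds hold.\<close>
  define r where "r = min d (min (\<delta> - dist pbar p) (\<delta> - dist zbar z))"
  define t where "t = r / (2 * C)"
  have r: "r > 0" using d(1) p z by (simp add: r_def)
  have t: "t > 0" "t * C < r" using r C(1) by (auto simp: t_def)
  have tx: "t * x < r" if "x \<le> C" for x
    using mult_left_mono[OF that, of t] t by linarith
  define p' where "p' = p + j (t *\<^sub>R e)"
  have pp': "norm (p' - p) \<le> t * (J * norm e)"
    using J(2)[of "t *\<^sub>R e"] t(1) by (simp add: p'_def mult_ac)
  have "dist pbar p' \<le> dist pbar p + norm (p' - p)"
    by (metis dist_norm dist_triangle dist_commute)
  then have p': "p' \<in> ball pbar \<delta>" using pp' tx[OF C(2)] by (simp add: r_def)
  have "z \<in> S p" using graph S_iff W'[OF p] z by (auto simp: gph_def)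
  then obtain z' where z': "z' \<in> S p'" "norm (z - z') \<le> \<kappa> * norm (p' - p)"
    using aubin(2)[OF p p'] z by blast
  define \<Delta> where "\<Delta> = z' - z"
  have "norm \<Delta> \<le> \<kappa> * (t * (J * norm e))"
    unfolding \<Delta>_def norm_minus_commute[of z' z]
    by (rule order_trans[OF z'(2) mult_left_mono[OF pp']]) (use aubin(1) in simp)
  then have \<Delta>: "norm \<Delta> \<le> t * R" by (simp add: R_def mult_ac)
  have "dist zbar z' \<le> dist zbar z + norm \<Delta>"
    unfolding \<Delta>_def by (metis dist_norm dist_triangle dist_commute)
  then have zb: "z' \<in> ball zbar \<delta>" using \<Delta> tx[OF C(3)] by (simp add: r_def)
  define err where "err = H (p, z') - H (p, z) - B \<Delta>"
  have err: "norm err \<le> \<eta> * norm \<Delta>" using strict[OF p zb z] by (simp add: err_def \<Delta>_def)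
  have H': "H (p', z') - H (p, z) = t *\<^sub>R e + B \<Delta> + err" by (simp add: p'_def j(2) err_def)
  have graph': "(z', H (p', z')) \<in> gph M" using z'(1) S_iff W'[OF p'] zb by (auto simp: gph_def)
  have "norm (H (p', z') - H (p, z)) \<le> t * norm e + norm (B \<Delta>) + norm err"
    unfolding H' using norm_triangle_le[OF add_mono[OF norm_triangle_ineq[of "t *\<^sub>R e" "B \<Delta>"] order_refl]] t(1)
    by simp
  also have "\<dots> \<le> t * norm e + norm \<Delta> * \<beta> + \<eta> * norm \<Delta>"
    using \<beta>(2)[of \<Delta>] err by simp
  finally have "norm ((z', H (p', z')) - (z, H (p, z))) \<le> norm \<Delta> + (t * norm e + norm \<Delta> * \<beta> + \<eta> * norm \<Delta>)"
    using norm_Pair_le[of \<Delta> "H (p', z') - H (p, z)"] by (simp add: \<Delta>_def)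
  also have "\<dots> = t * norm e + (1 + \<beta> + \<eta>) * norm \<Delta>" by (simp add: algebra_simps)
  also have "\<dots> \<le> t * norm e + (1 + \<beta> + \<eta>) * (t * R)"
    using \<beta>(1) \<eta> by (intro add_left_mono mult_left_mono \<Delta>) auto
  also have "\<dots> = t * (norm e + (1 + \<beta> + \<eta>) * R)" by (simp add: algebra_simps)
  also have "\<dots> \<le> t * C" using C(4) t(1) by simp
  finally have nc: "norm ((z', H (p', z')) - (z, H (p, z))) \<le> t * C" .
  then have "(a, b) \<bullet> ((z', H (p', z')) - (z, H (p, z))) \<le> \<epsilon> / C * norm ((z', H (p', z')) - (z, H (p, z)))"
    using t(2) by (intro d(2) graph') (simp add: dist_norm r_def)
  also have "\<dots> \<le> \<epsilon> / C * (t * C)" using nc \<open>\<epsilon> > 0\<close> C(1) by (intro mult_left_mono) auto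
  also have "\<dots> = t * \<epsilon>" using C(1) by simp
  finally have "a \<bullet> \<Delta> + b \<bullet> (H (p', z') - H (p, z)) \<le> t * \<epsilon>" by (simp add: inner_diff_right \<Delta>_def)
  \<comment> \<open>The term \<open>b \<bullet> B \<Delta>\<close> moves to the adjoint side and
    combines with \<open>a \<bullet> \<Delta>\<close>; only this combination is known to vanish in
    the limit.\<close>
  then have "t * (b \<bullet> e) \<le> t * \<epsilon> - (a + adjoint B b) \<bullet> \<Delta> - b \<bullet> err"
    by (simp add: H' inner_add_left inner_add_right inner_adjoint_B(2))
  also have "\<dots> \<le> t * \<epsilon> + norm (a + adjoint B b) * norm \<Delta> + norm b * norm err"
    using Cauchy_Schwarz_ineq2[of "a + adjoint B b" \<Delta>] Cauchy_Schwarz_ineq2[of b err]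
    unfolding abs_le_iff by linarith
  also have "\<dots> \<le> t * \<epsilon> + norm (a + adjoint B b) * norm \<Delta> + norm b * (\<eta> * norm \<Delta>)"
    using err by (simp add: mult_left_mono)
  also have "\<dots> = t * \<epsilon> + (norm (a + adjoint B b) + \<eta> * norm b) * norm \<Delta>" by (simp add: algebra_simps)
  also have "\<dots> \<le> t * \<epsilon> + (norm (a + adjoint B b) + \<eta> * norm b) * (t * R)"
    using \<eta> by (intro add_left_mono mult_left_mono \<Delta>) auto
  also have "\<dots> = t * (R * (norm (a + adjoint B b) + \<eta> * norm b) + \<epsilon>)" by (simp add: algebra_simps)
  finally show "b \<bullet> e \<le> \<kappa> * J * norm e * (norm (a + adjoint B b) + \<eta> * norm b) + \<epsilon>"
    using t(1) by (simp add: R_def)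
qed

text \<open>The regular normals approximating \<open>(adjoint B \<zeta>, - \<zeta>)\<close> satisfy
  \<open>a k + adjoint B (b k)\<close> \<rightarrow> \<open>0\<close>. In the estimate for
  \<open>e = - \<zeta>\<close> only the strict differentiability error \<eta> then survives, and it
  is arbitrary.\<close>

lemma aubin_imp_coderivative_kernel:
  assumes j: "bounded_linear j" "\<And>p e z. H (p + j e, z) = H (p, z) + e"
    and aubin: "aubin_property S pbar zbar"
    and \<zeta>: "adjoint B \<zeta> \<in> coderivative UNIV UNIV M zbar (H (pbar, zbar)) \<zeta>"
  shows "\<zeta> = 0"
proof -
  interpret B: bounded_linear B by (rule B_linear)
  interpret j: bounded_linear j by (rule j(1))
  obtain \<delta>0 \<kappa> where aub: "\<delta>0 > 0" "\<kappa> > 0"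
    "\<And>p p' z. p \<in> ball pbar \<delta>0 \<Longrightarrow> p' \<in> ball pbar \<delta>0 \<Longrightarrow> z \<in> S p \<inter> ball zbar \<delta>0 \<Longrightarrow>
       \<exists>z'\<in>S p'. norm (z - z') \<le> \<kappa> * norm (p' - p)"
    using aubin unfolding aubin_property_iff by metis
  obtain J where J: "J > 0" "\<And>e. norm (j e) \<le> norm e * J" using j.pos_bounded by blast
  have "(adjoint B \<zeta>, - \<zeta>) \<in> limiting_normal_cone UNIV (gph M) (zbar, H (pbar, zbar))"
    using \<zeta> by (simp add: coderivative_def)
  then obtain cs ns where seq: "cs \<longlonglongrightarrow> (zbar, H (pbar, zbar))" "ns \<longlonglongrightarrow> (adjoint B \<zeta>, - \<zeta>)"
    "\<And>k. cs k \<in> gph M" "\<And>k. ns k \<in> regular_normal_cone UNIV (gph M) (cs k)"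
    by (rule limiting_normal_coneE) (rule that)
  define zs ms a b where "zs k = fst (cs k)" and "ms k = snd (cs k)"
    and "a k = fst (ns k)" and "b k = snd (ns k)" for k
  have zs: "zs \<longlonglongrightarrow> zbar" and ms: "ms \<longlonglongrightarrow> H (pbar, zbar)"
    and a: "a \<longlonglongrightarrow> adjoint B \<zeta>" and b: "b \<longlonglongrightarrow> - \<zeta>"
    using tendsto_fst[OF seq(1)] tendsto_snd[OF seq(1)] tendsto_fst[OF seq(2)] tendsto_snd[OF seq(2)]
    by (auto simp: zs_def[abs_def] ms_def[abs_def] a_def[abs_def] b_def[abs_def])
  have csm: "cs k = (zs k, ms k)" and ns: "ns k = (a k, b k)" for k
    by (simp_all add: zs_def ms_def a_def b_def)
  have ab0: "(\<lambda>k. norm (a k + adjoint B (b k))) \<longlonglongrightarrow> 0"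
  proof -
    have lin: "bounded_linear (adjoint B)"
      using adjoint_linear B.linear linear_conv_bounded_linear by blast
    have "(\<lambda>k. a k + adjoint B (b k)) \<longlonglongrightarrow> adjoint B \<zeta> + adjoint B (- \<zeta>)"
      by (intro tendsto_add a bounded_linear.tendsto[OF lin] b)
    then show ?thesis using lin by (simp add: linear_simps tendsto_norm_zero)
  qed
  \<comment> \<open>An approximating graph point need not satisfy
    \<open>ms k = H (pbar, zs k)\<close>. Shifting the parameter by the defect makes
    \<open>zs k\<close> an exact solution for \<open>q k\<close>, and the defect tends to
    \<open>0\<close>.\<close>
  define q where "q k = pbar + j (ms k - H (pbar, zs k))" for k
  have Hzs: "(\<lambda>k. H (pbar, zs k)) \<longlonglongrightarrow> H (pbar, zbar)"
    using isCont_tendsto_compose[OF has_derivative_continuous[OF B] zs] .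
  have q: "q \<longlonglongrightarrow> pbar"
  proof -
    have "(\<lambda>k. pbar + j (ms k - H (pbar, zs k))) \<longlonglongrightarrow> pbar + j (H (pbar, zbar) - H (pbar, zbar))"
      by (intro tendsto_intros j.tendsto ms Hzs)
    then show ?thesis by (simp add: q_def[abs_def] j.zero)
  qed
  have Hq: "H (q k, zs k) = ms k" for k by (simp add: q_def j(2))
  have main: "- \<zeta> \<bullet> - \<zeta> \<le> \<kappa> * J * norm (- \<zeta>) * (0 + \<eta> * norm (- \<zeta>))" if \<eta>: "\<eta> > 0" for \<eta>
  proof -
    obtain \<delta>1 where \<delta>1: "\<delta>1 > 0" "\<And>p. p \<in> ball pbar \<delta>1 \<Longrightarrow> ball zbar \<delta>1 \<subseteq> {z. (p, z) \<in> W}"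
      "\<And>p z z'. p \<in> ball pbar \<delta>1 \<Longrightarrow> z \<in> ball zbar \<delta>1 \<Longrightarrow> z' \<in> ball zbar \<delta>1 \<Longrightarrow>
       norm (H (p, z) - H (p, z') - B (z - z')) \<le> \<eta> * norm (z - z')"
      using partial_strict[OF \<eta>] by blast
    define \<delta> where "\<delta> = min \<delta>0 \<delta>1"
    have "\<delta> > 0" using aub(1) \<delta>1(1) by (simp add: \<delta>_def)
    have blp: "ball x \<delta> \<subseteq> ball x \<delta>0" "ball x \<delta> \<subseteq> ball x \<delta>1" for x :: 'q
      by (auto simp: \<delta>_def)
    have bl: "ball x \<delta> \<subseteq> ball x \<delta>0" "ball x \<delta> \<subseteq> ball x \<delta>1" for x :: 'z
      by (auto simp: \<delta>_def)
    have "\<forall>\<^sub>F k in sequentially. q k \<in> ball pbar \<delta> \<and> zs k \<in> ball zbar \<delta>"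
      using tendstoD[OF q \<open>\<delta> > 0\<close>] tendstoD[OF zs \<open>\<delta> > 0\<close>]
      by eventually_elim (simp add: dist_commute)
    then have "\<forall>\<^sub>F k in sequentially.
        b k \<bullet> - \<zeta> \<le> \<kappa> * J * norm (- \<zeta>) * (norm (a k + adjoint B (b k)) + \<eta> * norm (b k))"
    proof eventually_elim
      case (elim k)
      show ?case
      proof (rule regular_normal_estimate[OF j less_imp_le[OF J(1)] J(2) aub(2)])
        show "\<eta> \<ge> 0" using \<eta> by simp
        show "q k \<in> ball pbar \<delta>" "zs k \<in> ball zbar \<delta>" using elim by blast+
        show "(zs k, H (q k, zs k)) \<in> gph M" using seq(3)[of k] by (simp add: csm Hq)
        show "(a k, b k) \<in> regular_normal_cone UNIV (gph M) (zs k, H (q k, zs k))"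
          using seq(4)[of k] by (simp add: csm ns Hq)
        show "\<exists>z'\<in>S p'. norm (z - z') \<le> \<kappa> * norm (p' - p)"
          if "p \<in> ball pbar \<delta>" "p' \<in> ball pbar \<delta>" "z \<in> S p \<inter> ball zbar \<delta>" for p p' z
          using aub(3)[of p p' z] that bl(1) blp(1) by blast
        show "ball zbar \<delta> \<subseteq> {z. (p, z) \<in> W}" if "p \<in> ball pbar \<delta>" for p
          using \<delta>1(2)[of p] that bl(2) blp(2) by blast
        show "norm (H (p, z) - H (p, z') - B (z - z')) \<le> \<eta> * norm (z - z')"
          if "p \<in> ball pbar \<delta>" "z \<in> ball zbar \<delta>" "z' \<in> ball zbar \<delta>" for p z z'
          using \<delta>1(3)[of p z z'] that bl(2) blp(2) by blast
      qed
    qed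
    moreover have "(\<lambda>k. \<kappa> * J * norm (- \<zeta>) * (norm (a k + adjoint B (b k)) + \<eta> * norm (b k)))
        \<longlonglongrightarrow> \<kappa> * J * norm (- \<zeta>) * (0 + \<eta> * norm (- \<zeta>))"
      by (rule tendsto_mult_left[OF tendsto_add[OF ab0 tendsto_mult_left[OF tendsto_norm[OF b]]]])
    ultimately show ?thesis
      by (intro tendsto_le[OF trivial_limit_sequentially _ tendsto_inner[OF b tendsto_const]])
  qed
  have "norm \<zeta> ^ 2 \<le> 0 + \<eta>" if "\<eta> > 0" for \<eta>
  proof -
    \<comment> \<open>Rescaling \<eta> by \<open>c\<close> absorbs the constant factor; the summand
      \<open>1\<close> keeps the divisor positive when \<open>\<zeta> = 0\<close>.\<close>
    define c where "c = \<kappa> * J * norm \<zeta> * norm \<zeta> + 1"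
    have c: "c > 0" using aub(2) J(1) by (simp add: c_def add_nonneg_pos)
    have "norm \<zeta> ^ 2 \<le> (\<kappa> * J * norm \<zeta> * norm \<zeta>) * (\<eta> / c)"
      using main[of "\<eta> / c"] that c
      by (simp add: power2_norm_eq_inner mult_ac)
    also have "\<dots> \<le> c * (\<eta> / c)" using that c by (intro mult_right_mono) (auto simp: c_def)
    finally show ?thesis using c by simp
  qed
  then have "norm \<zeta> ^ 2 \<le> 0" by (rule field_le_epsilon)
  then show ?thesis by simp
qed

text \<open>The modulus obtained is \<open>L / \<gamma>\<close>: the old solution \<open>z\<close>
  has residual at most \<open>\<rho> = L * norm (p' - p)\<close> for the new parameter, and the
  penalised minimiser lies within \<open>\<rho> / \<gamma>\<close> of the old graph point.\<close>

lemma coderivative_kernel_imp_aubin: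
  assumes inj: "\<And>\<zeta>. adjoint B \<zeta> \<in> coderivative UNIV UNIV M zbar (H (pbar, zbar)) \<zeta> \<Longrightarrow> \<zeta> = 0"
  shows "aubin_property S pbar zbar"
proof -
  define cbar where "cbar = (zbar, H (pbar, zbar))"
  have adjB: "bounded_linear (adjoint B)"
    using adjoint_linear B_linear linear_conv_bounded_linear by blast
  interpret adjB: bounded_linear "adjoint B" by (rule adjB)
  have cbar: "cbar \<in> gph M" using sol S_iff[OF W(2)] by (simp add: cbar_def gph_def)
  obtain \<kappa> r0 where \<kappa>: "\<kappa> > 0" "r0 > 0"
    "\<And>c' a b. c' \<in> gph M \<Longrightarrow> dist c' cbar < r0 \<Longrightarrow> (a, b) \<in> regular_normal_cone UNIV (gph M) c' \<Longrightarrow>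
       \<kappa> * norm b \<le> norm (a + adjoint B b)"
  proof (rule regular_normals_lower_bound[OF cbar adjB])
    fix b assume "(- adjoint B b, b) \<in> limiting_normal_cone UNIV (gph M) cbar"
    then have "- b = 0" by (intro inj) (simp add: coderivative_def cbar_def adjB.neg)
    then show "b = 0" by simp
  qed (rule that)
  obtain \<beta> where \<beta>: "\<beta> > 0" "\<And>x. norm (adjoint B x) \<le> norm x * \<beta>" using adjB.pos_bounded by blast
  \<comment> \<open>Calibrated for the final contradiction. The penalty gradient has norm at most
    \<open>2 * \<gamma>\<close>, so the first bound keeps the normal's second part at least
    \<open>3 / 4\<close> long, and the second limits the effect of the penalty on
    \<open>a + adjoint B b\<close> to \<open>\<kappa> / 8\<close>.\<close>
  define \<gamma> where "\<gamma> = min (1/8) (\<kappa> / (16 * (1 + \<beta>)))"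
  have \<gamma>: "\<gamma> > 0" "2 * \<gamma> \<le> 1 / 4" "2 * \<gamma> * (1 + \<beta>) \<le> \<kappa> / 8"
  proof -
    have "\<gamma> * (16 * (1 + \<beta>)) \<le> \<kappa> / (16 * (1 + \<beta>)) * (16 * (1 + \<beta>))"
      using \<beta>(1) by (intro mult_right_mono) (auto simp: \<gamma>_def)
    also have "\<dots> = \<kappa>" using \<beta>(1) by simp
    finally show "2 * \<gamma> * (1 + \<beta>) \<le> \<kappa> / 8" by (simp add: algebra_simps)
  qed (use \<kappa>(1) \<beta>(1) in \<open>auto simp: \<gamma>_def\<close>)
  obtain \<delta>1 where \<delta>1: "\<delta>1 > 0" "\<And>p. p \<in> ball pbar \<delta>1 \<Longrightarrow> ball zbar \<delta>1 \<subseteq> {z. (p, z) \<in> W}"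
    "\<And>p z z'. p \<in> ball pbar \<delta>1 \<Longrightarrow> z \<in> ball zbar \<delta>1 \<Longrightarrow> z' \<in> ball zbar \<delta>1 \<Longrightarrow>
       norm (H (p, z) - H (p, z') - B (z - z')) \<le> \<kappa> / 4 * norm (z - z')"
    using partial_strict[of "\<kappa> / 4"] \<kappa>(1) by auto
  obtain L \<delta>2 where L: "L > 0" "\<delta>2 > 0"
    "\<And>a b. a \<in> ball (pbar, zbar) \<delta>2 \<Longrightarrow> b \<in> ball (pbar, zbar) \<delta>2 \<Longrightarrow> norm (H a - H b) \<le> L * norm (a - b)"
    by (rule strictly_differentiable_lipschitz[OF smooth[OF W(2)]]) (rule that)
  define R where "R = min r0 \<delta>1"
  have R: "R > 0" using \<kappa>(2) \<delta>1(1) by (simp add: R_def)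
  \<comment> \<open>For data within \<delta>, the old graph point is at distance at most
    \<open>\<delta> * (1 + 2 * L)\<close> from \<open>cbar\<close>, and the minimiser moves by at
    most \<open>\<delta> * (2 * L / \<gamma>)\<close> more. Hence
    \<open>\<delta> * \<Lambda>\<close> bounds the distance of the minimiser from
    \<open>cbar\<close>.\<close>
  define \<Lambda> where "\<Lambda> = 1 + 2 * L + 2 * L / \<gamma>"
  have \<Lambda>: "\<Lambda> > 0" using L(1) \<gamma>(1) by (simp add: \<Lambda>_def add_pos_pos)
  \<comment> \<open>The last bound gives \<open>\<delta> * \<Lambda> \<le> R / 4\<close>, so a
    minimiser over the ball of radius \<open>R / 2\<close> cannot lie on the boundary of that ball.
    The halves place pairs within \<delta> in the product ball on which \<open>L\<close> is a
    Lipschitz modulus.\<close>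
  define \<delta> where "\<delta> = min (min (\<delta>1 / 2) (\<delta>2 / 2)) (R / (4 * \<Lambda>))"
  have "\<delta> * \<Lambda> \<le> R / (4 * \<Lambda>) * \<Lambda>"
    using \<Lambda> by (intro mult_right_mono) (auto simp: \<delta>_def)
  then have "\<delta> * \<Lambda> \<le> R / 4" using \<Lambda> by simp
  moreover have "\<delta> > 0" using R \<Lambda> \<delta>1(1) L(2) by (simp add: \<delta>_def)
  moreover have "\<delta> \<le> \<delta>1 / 2" "\<delta> \<le> \<delta>2 / 2" unfolding \<delta>_def by linarith+
  ultimately have \<delta>: "\<delta> > 0" "\<delta> \<le> \<delta>1 / 2" "\<delta> \<le> \<delta>2 / 2" "\<delta> * (1 + 2 * L + 2 * L / \<gamma>) \<le> R / 4"
    by (auto simp: \<Lambda>_def)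
  have near2: "(p, z) \<in> ball (pbar, zbar) \<delta>2" if "p \<in> ball pbar \<delta>" "z \<in> ball zbar \<delta>" for p z
  proof -
    have "dist (pbar, zbar) (p, z) \<le> dist pbar p + dist zbar z"
      using norm_Pair_le[of "pbar - p" "zbar - z"] by (simp add: dist_norm)
    also have "\<dots> < \<delta>2" using that \<delta>(3) by simp
    finally show ?thesis by simp
  qed
  have "\<exists>z'\<in>S p'. norm (z - z') \<le> (L / \<gamma>) * norm (p' - p)"
    if p: "p \<in> ball pbar \<delta>" and p': "p' \<in> ball pbar \<delta>" and z: "z \<in> S p \<inter> ball zbar \<delta>" for p p' z
  proof (cases "p' = p")
    case True
    then show ?thesis using z by (intro bexI[of _ z]) auto
  next
    case False
    define \<rho> where "\<rho> = L * norm (p' - p)"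
    have \<rho>: "\<rho> > 0" using False L(1) by (simp add: \<rho>_def)
    have "p \<in> ball pbar \<delta>1" "z \<in> ball zbar \<delta>1" using p z \<delta>(1,2) \<delta>1(1) by auto
    then have zW: "(p, z) \<in> W" using \<delta>1(2) by blast
    define c where "c = (z, H (p, z))"
    have c: "c \<in> gph M" using z S_iff[OF zW] by (simp add: c_def gph_def)
    have cdist: "dist c cbar \<le> \<delta> * (1 + 2 * L)"
    proof -
      have "norm (H (p, z) - H (pbar, zbar)) \<le> L * norm ((p, z) - (pbar, zbar))"
        using near2[OF p] z \<delta>(1) L(2) by (intro L(3)) auto
      also have "\<dots> \<le> L * (norm (p - pbar) + norm (z - zbar))"
        using norm_Pair_le[of "p - pbar" "z - zbar"] L(1) by (intro mult_left_mono) auto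
      also have "\<dots> \<le> L * (\<delta> + \<delta>)"
        using p z L(1) by (intro mult_left_mono add_mono) (auto simp: dist_norm norm_minus_commute)
      finally have "norm (H (p, z) - H (pbar, zbar)) \<le> L * (\<delta> + \<delta>)" .
      moreover have "norm (z - zbar) \<le> \<delta>" using z by (auto simp: dist_norm norm_minus_commute)
      ultimately show ?thesis
        using norm_Pair_le[of "z - zbar" "H (p, z) - H (pbar, zbar)"]
        by (simp add: dist_norm c_def cbar_def algebra_simps)
    qed
    have p1: "p' \<in> ball pbar \<delta>1" using p' \<delta>(1,2) \<delta>1(1) by auto
    have fst_near: "fst c' \<in> ball zbar \<delta>1" if "dist c' cbar < R" for c'
      using that dist_fst_le[of c' cbar] by (auto simp: cbar_def R_def dist_commute)
    text \<open>The weight of the penalty makes its value at a minimiser at most \<open>\<rho>\<close>, hence bounds the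
      distance to \<open>c\<close> by \<open>\<rho> / \<gamma>\<close> and the gradient of the penalty by \<open>2 * \<gamma>\<close>.  Being smooth, the penalty
      can be used in Fermat's rule directly, without Ekeland's principle or a sum rule.\<close>
    define \<phi> where "\<phi> c' = norm (snd c' - H (p', fst c')) + \<gamma>\<^sup>2 / \<rho> * (norm (c' - c))\<^sup>2" for c'
    \<comment> \<open>Closedness of the graph makes \<open>Q\<close> compact, so a minimiser exists;
      radius \<open>R / 2\<close> leaves room inside the region where the normal bound and the
      smoothness of \<open>H\<close> are available.\<close>
    define Q where "Q = gph M \<inter> cball cbar (R / 2)"
    have "compact Q" unfolding Q_def using closed by (intro closed_Int_compact) auto
    have cQ: "c \<in> Q"
    proof -
      have "\<delta> * (1 + 2 * L) \<le> \<delta> * (1 + 2 * L + 2 * L / \<gamma>)"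
        using \<delta>(1) L(1) \<gamma>(1) by (intro mult_left_mono) auto
      then have "dist c cbar \<le> R / 2" using cdist \<delta>(4) R by linarith
      then show ?thesis using c by (simp add: Q_def dist_commute)
    qed
    have dH: "\<exists>B'. ((\<lambda>z. H (p', z)) has_derivative B') (at z')" if "z' \<in> ball zbar \<delta>1" for z'
    proof -
      have "(p', z') \<in> W" using \<delta>1(2)[OF p1] that by blast
      then obtain D where D: "(H has_derivative D) (at (p', z'))"
        using strictly_differentiable_imp_differentiable[OF smooth] by (auto simp: differentiable_def)
      have "((\<lambda>z. (p', z)) has_derivative (\<lambda>h. (0, h))) (at z')"
        by (auto intro!: derivative_eq_intros)
      from has_derivative_compose[OF this D] show ?thesis by blast
    qed
    have "continuous_on Q \<phi>"
    proof -
      have "continuous_on (ball zbar \<delta>1) (\<lambda>z. H (p', z))"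
        using dH has_derivative_continuous by (intro continuous_at_imp_continuous_on) blast
      moreover have "fst ` Q \<subseteq> ball zbar \<delta>1"
      proof (rule image_subsetI)
        fix c' assume "c' \<in> Q"
        then have "dist c' cbar \<le> R / 2" by (simp add: Q_def dist_commute)
        then show "fst c' \<in> ball zbar \<delta>1" using R by (intro fst_near) simp
      qed
      ultimately have "continuous_on Q (\<lambda>c'. H (p', fst c'))"
        by (rule continuous_on_compose2[OF _ continuous_on_fst[OF continuous_on_id]])
      then show ?thesis unfolding \<phi>_def by (intro continuous_intros)
    qed
    then obtain cm where cm: "cm \<in> Q" "\<And>c'. c' \<in> Q \<Longrightarrow> \<phi> cm \<le> \<phi> c'"
      using continuous_attains_inf[OF \<open>compact Q\<close>] cQ by blast
    obtain zm mm where cmp: "cm = (zm, mm)" by (cases cm)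
    have "\<phi> c \<le> \<rho>"
    proof -
      have "norm (H (p, z) - H (p', z)) \<le> L * norm ((p, z) - (p', z))"
        using near2[OF p] near2[OF p'] z by (intro L(3)) auto
      then show ?thesis by (simp add: \<phi>_def c_def \<rho>_def norm_minus_commute)
    qed
    then have "\<phi> cm \<le> \<rho>" using cm(2)[OF cQ] by linarith
    then have "\<gamma>\<^sup>2 / \<rho> * (norm (cm - c))\<^sup>2 \<le> \<rho>"
      unfolding \<phi>_def using norm_ge_zero[of "snd cm - H (p', fst cm)"] by linarith
    then have "(\<gamma> * norm (cm - c))\<^sup>2 \<le> \<rho>\<^sup>2"
      using \<rho> by (simp add: field_simps power2_eq_square)
    then have gcm: "\<gamma> * norm (cm - c) \<le> \<rho>"
      using \<rho> by (auto intro: power2_le_imp_le)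
    have cmc: "norm (cm - c) \<le> \<rho> / \<gamma>" using gcm \<gamma>(1) by (simp add: field_simps)
    have "norm (p' - p) \<le> 2 * \<delta>"
      using p p' norm_triangle_ineq4[of "p' - pbar" "p - pbar"]
      by (simp add: dist_norm norm_minus_commute)
    then have "\<rho> / \<gamma> \<le> \<delta> * (2 * L / \<gamma>)"
      using L(1) \<gamma>(1) by (simp add: \<rho>_def field_simps)
    then have "dist cm cbar \<le> \<delta> * (1 + 2 * L) + \<delta> * (2 * L / \<gamma>)"
      using cmc cdist dist_triangle[of cm cbar c] unfolding dist_norm by linarith
    also have "\<dots> = \<delta> * (1 + 2 * L + 2 * L / \<gamma>)" by (simp only: distrib_left)
    also have "\<dots> < R / 2" using \<delta>(4) R by linarith
    finally have cmR: "dist cm cbar < R / 2" .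
    have zm1: "zm \<in> ball zbar \<delta>1" using fst_near[of cm] cmR R by (simp add: cmp)
    have "mm = H (p', zm)"
    \<comment> \<open>A nonzero residual is exactly what makes its norm differentiable at
      \<open>cm\<close>, with gradient the unit vector \<open>v\<close> in the residual
      direction.\<close>
    proof (rule ccontr)
      assume "mm \<noteq> H (p', zm)"
      define v where "v = sgn (mm - H (p', zm))"
      have v: "norm v = 1" using \<open>mm \<noteq> H (p', zm)\<close> by (simp add: v_def norm_sgn)
      obtain B' where B': "((\<lambda>z. H (p', z)) has_derivative B') (at zm)" using dH[OF zm1] by blast
      interpret B': bounded_linear B' using B' by (rule has_derivative_bounded_linear)
      define s where "s = (2 * \<gamma>\<^sup>2 / \<rho>) *\<^sub>R (cm - c)"
      have sn: "norm s \<le> 2 * \<gamma>"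
      proof -
        have "norm s = 2 * \<gamma> / \<rho> * (\<gamma> * norm (cm - c))"
          using \<rho> \<gamma>(1) by (simp add: s_def power2_eq_square)
        also have "\<dots> \<le> 2 * \<gamma> / \<rho> * \<rho>" using gcm \<rho> \<gamma>(1) by (intro mult_left_mono) auto
        finally show ?thesis using \<rho> by simp
      qed
      obtain s1 s2 where s12: "s = (s1, s2)" by (cases s)
      have s1: "norm s1 \<le> 2 * \<gamma>" and s2: "norm s2 \<le> 2 * \<gamma>"
        using sn norm_fst_le[of s1 s2] norm_snd_le[of s2 s1] by (auto simp: s12)
      have adjB': "B' x \<bullet> y = x \<bullet> adjoint B' y" for x y
        using adjoint_works[of B' x y] B'.linear by simp
      \<comment> \<open>The gradient of \<open>\<phi>\<close> at \<open>cm\<close>: the residual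
        norm contributes \<open>(- adjoint B' v, v)\<close> and the penalty contributes
        \<open>s\<close>.\<close>
      define g where "g = (- adjoint B' v + s1, v + s2)"
      have d1: "((\<lambda>c'. snd c' - H (p', fst c')) has_derivative (\<lambda>h. snd h - B' (fst h))) (at cm)"
        using has_derivative_compose[OF has_derivative_fst[OF has_derivative_ident], of "\<lambda>z. H (p', z)" B' cm]
          B' by (intro has_derivative_diff has_derivative_snd has_derivative_ident) (auto simp: cmp)
      have d2: "((\<lambda>c'. norm (snd c' - H (p', fst c'))) has_derivative (\<lambda>h. (snd h - B' (fst h)) \<bullet> v)) (at cm)"
        using has_derivative_compose[OF d1 has_derivative_norm] \<open>mm \<noteq> H (p', zm)\<close>
        by (simp add: cmp v_def)
      have d3: "((\<lambda>c'. \<gamma>\<^sup>2 / \<rho> * (norm (c' - c))\<^sup>2) has_derivative (\<lambda>h. s \<bullet> h)) (at cm)"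
        unfolding power2_norm_eq_inner using \<rho>
        by (auto intro!: derivative_eq_intros simp: s_def inner_commute algebra_simps)
      have "(\<phi> has_derivative (\<lambda>h. g \<bullet> h)) (at cm)"
      proof -
        have "(snd h - B' (fst h)) \<bullet> v + s \<bullet> h = g \<bullet> h" for h
          by (simp add: g_def s12 inner_prod_def inner_add_left inner_diff_left adjB'
              inner_commute[of "fst h"] inner_commute[of "snd h"])
        then show ?thesis using has_derivative_add[OF d2 d3] by (simp add: \<phi>_def[abs_def])
      qed
      then have "- g \<in> regular_normal_cone UNIV (gph M) cm"
      proof (rule fermat_regular_normal[rotated])
        show "cm \<in> gph M" using cm(1) by (simp add: Q_def)
        \<comment> \<open>Graph points within this radius of \<open>cm\<close> remain in
          \<open>Q\<close>, so the minimum over \<open>Q\<close> is a local minimum over the whole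
          graph.\<close>
        show "R / 2 - dist cm cbar > 0" using cmR by simp
        show "\<phi> cm \<le> \<phi> c'" if "c' \<in> gph M" "dist c' cm < R / 2 - dist cm cbar" for c'
          using that dist_triangle[of c' cbar cm] by (intro cm(2)) (simp add: Q_def dist_commute)
      qed
      \<comment> \<open>The uniform bound applied to \<open>- g\<close>, whose second part is
        \<open>- v - s2\<close>.\<close>
      then have low: "\<kappa> * norm (- v - s2) \<le> norm ((adjoint B' v - s1) + adjoint B (- v - s2))"
        using cm(1) cmR R by (intro \<kappa>(3)[of cm]) (auto simp: g_def Q_def R_def)
      \<comment> \<open>The bound refers to \<open>B\<close>, whereas Fermat's rule produces the
        derivative \<open>B'\<close> at \<open>zm\<close>. Testing the difference of derivatives on
        \<open>y\<close>, the difference of the adjoints at \<open>v\<close>, gives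
        \<open>norm y * norm y\<close>, so the tolerance \<open>\<kappa> / 4\<close> carries
        over.\<close>
      have BB: "norm (adjoint B' v - adjoint B v) \<le> \<kappa> / 4"
      proof -
        define y where "y = adjoint B' v - adjoint B v"
        have dd: "((\<lambda>z. H (p', z) - B z) has_derivative (\<lambda>h. B' h - B h)) (at zm)"
          by (intro has_derivative_diff B' bounded_linear_imp_has_derivative B_linear)
        obtain d where "d > 0" "ball zm d \<subseteq> ball zbar \<delta>1"
          using zm1 open_ball open_contains_ball by blast
        have "norm (B' y - B y) \<le> \<kappa> / 4 * norm y"
        proof (rule has_derivative_norm_le[OF dd \<open>d > 0\<close>])
          fix z' assume "norm (z' - zm) < d"
          then have "z' \<in> ball zm d" by (simp add: dist_norm norm_minus_commute)
          then have "z' \<in> ball zbar \<delta>1" using \<open>ball zm d \<subseteq> ball zbar \<delta>1\<close> by blast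
          then have "norm (H (p', z') - H (p', zm) - B (z' - zm)) \<le> \<kappa> / 4 * norm (z' - zm)"
            by (intro \<delta>1(3) p1 zm1)
          then show "norm (H (p', z') - B z' - (H (p', zm) - B zm)) \<le> \<kappa> / 4 * norm (z' - zm)"
            by (simp add: bounded_linear.linear[OF B_linear] linear_diff algebra_simps)
        qed
        then have "(B' y - B y) \<bullet> v \<le> \<kappa> / 4 * norm y"
          using norm_cauchy_schwarz[of "B' y - B y" v] v by simp
        moreover have "(B' y - B y) \<bullet> v = y \<bullet> (adjoint B' v - adjoint B v)"
          by (simp add: inner_diff_left inner_diff_right adjB' inner_adjoint_B(1))
        then have "(B' y - B y) \<bullet> v = norm y * norm y"
          by (simp flip: y_def add: dot_square_norm power2_eq_square)
        ultimately have "norm y * norm y \<le> \<kappa> / 4 * norm y" by simp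
        then show ?thesis using \<kappa>(1) unfolding y_def[symmetric]
          by (cases "norm y = 0") (auto simp: mult_le_cancel_right)
      qed
      \<comment> \<open>The main terms in \<open>v\<close> nearly cancel, leaving at most
        \<open>3 * \<kappa> / 8\<close>, while the unit length of \<open>v\<close> forces at least
        \<open>3 * \<kappa> / 4\<close> on the other side of \<open>low\<close>.\<close>
      have "norm ((adjoint B' v - s1) + adjoint B (- v - s2))
          = norm ((adjoint B' v - adjoint B v) - (s1 + adjoint B s2))"
        by (simp add: adjB.diff adjB.neg algebra_simps)
      also have "\<dots> \<le> \<kappa> / 4 + (norm s1 + norm (adjoint B s2))"
        by (rule order_trans[OF norm_triangle_ineq4 add_mono[OF BB norm_triangle_ineq]])
      also have "\<dots> \<le> \<kappa> / 4 + (2 * \<gamma> + 2 * \<gamma> * \<beta>)"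
        using s1 \<beta>(2)[of s2] mult_right_mono[OF s2, of \<beta>] \<beta>(1) by linarith
      also have "\<dots> \<le> \<kappa> / 4 + \<kappa> / 8" using \<gamma>(3) by (simp add: algebra_simps)
      finally have "\<kappa> * norm (- v - s2) \<le> \<kappa> * (3 / 8)" using low by simp
      then have "norm (- v - s2) \<le> 3 / 8" using \<kappa>(1) by simp
      moreover have "norm (- v - s2) \<ge> 1 - 2 * \<gamma>"
        using norm_triangle_ineq2[of "- v" s2] v s2 by simp
      ultimately show False using \<gamma>(2) by simp
    qed
    then have "zm \<in> S p'"
      using cm(1) S_iff[of p' zm] \<delta>1(2)[OF p1] zm1 by (auto simp: cmp Q_def gph_def)
    moreover have "norm (z - zm) \<le> (L / \<gamma>) * norm (p' - p)"
      using cmc norm_fst_le[of "zm - z" "mm - H (p, z)"]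
      by (simp add: cmp c_def \<rho>_def norm_minus_commute)
    ultimately show ?thesis by blast
  qed
  then have "\<forall>p\<in>ball pbar \<delta>. \<forall>p'\<in>ball pbar \<delta>. \<forall>z\<in>S p \<inter> ball zbar \<delta>.
      \<exists>z'\<in>S p'. norm (z - z') \<le> (L / \<gamma>) * norm (p' - p)" by blast
  moreover have "L / \<gamma> > 0" using L(1) \<gamma>(1) by simp
  ultimately show ?thesis unfolding aubin_property_iff using sol \<delta>(1) by blast
qed

end

section \<open>Orthogonal decompositions\<close>

lemma component_unique:
  assumes "subspace E" "z \<in> E" "\<And>e. e \<in> E \<Longrightarrow> (y - z) \<bullet> e = 0"
  shows "component E y = z"
  unfolding component_def
proof (rule the_equality)
  show "z \<in> E \<and> y - z \<in> E\<^sup>\<bottom>"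
    using assms by (auto simp: orthogonal_comp_def orthogonal_def inner_commute)
  fix z' assume z': "z' \<in> E \<and> y - z' \<in> E\<^sup>\<bottom>"
  have "z' - z \<in> E" using assms z' by (simp add: subspace_diff)
  then have "(z' - z) \<bullet> (y - z) = 0" "(z' - z) \<bullet> (y - z') = 0"
    using assms(3)[of "z' - z"] z' by (auto simp: orthogonal_comp_def orthogonal_def inner_commute)
  then have "(z' - z) \<bullet> ((y - z) - (y - z')) = 0" by (simp only: inner_diff_right)
  then show "z' = z" by simp
qed

lemma component_properties:
  assumes "subspace E"
  shows component_in: "component E y \<in> E"
    and component_orthogonal: "e \<in> E \<Longrightarrow> (y - component E y) \<bullet> e = 0"
proof -
  obtain u v where uv: "u \<in> span E" "\<And>w. w \<in> span E \<Longrightarrow> orthogonal v w" "y = u + v"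
    using orthogonal_subspace_decomp_exists by metis
  have u: "u \<in> E" using uv(1) span_eq_iff assms by metis
  have v: "(y - u) \<bullet> e = 0" if "e \<in> E" for e
    using uv(2)[OF span_base[OF that]] uv(3) by (simp add: orthogonal_def)
  have "component E y = u" by (rule component_unique[OF assms u v])
  then show "component E y \<in> E" "e \<in> E \<Longrightarrow> (y - component E y) \<bullet> e = 0"
    using u v by simp_all
qed

lemma component_inner:
  assumes "subspace E" "e \<in> E"
  shows "component E y \<bullet> e = y \<bullet> e" "e \<bullet> component E y = e \<bullet> y"
  using component_orthogonal[OF assms, of y]
  by (simp_all add: inner_diff_left inner_commute[of e])

lemma component_id: "subspace E \<Longrightarrow> e \<in> E \<Longrightarrow> component E e = e"
  by (rule component_unique) auto

lemma linear_component:
  assumes "subspace E"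
  shows "linear (component E)"
proof (rule linearI)
  show "component E (x + y) = component E x + component E y" for x y
    by (rule component_unique[OF assms])
      (auto simp: assms subspace_add component_in component_inner inner_add_left inner_diff_left)
  show "component E (c *\<^sub>R x) = c *\<^sub>R component E x" for c x
    by (rule component_unique[OF assms])
      (auto simp: assms subspace_scale component_in component_inner inner_diff_left)
qed

lemma bounded_linear_component: "subspace E \<Longrightarrow> bounded_linear (component E)"
  using linear_component linear_conv_bounded_linear by blast

lemma component_sym:
  assumes "subspace E"
  shows "component E x \<bullet> y = x \<bullet> component E y"
  using component_inner[OF assms component_in[OF assms]] by metis

lemma norm_component_le:
  assumes "subspace E"
  shows "norm (component E x) \<le> norm x"
proof -
  have "norm (component E x) * norm (component E x) = x \<bullet> component E x"
    using component_inner(1)[OF assms component_in[OF assms], of x x]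
    by (simp add: dot_square_norm power2_eq_square)
  also have "\<dots> \<le> norm x * norm (component E x)" by (rule norm_cauchy_schwarz)
  finally show ?thesis by (cases "component E x = 0") auto
qed

context
  fixes E :: "'i::finite \<Rightarrow> 'a::euclidean_space set"
  assumes E: "orthogonal_decomposition E"
begin

lemma decomposition_subspace: "subspace (E i)"
  using E by (simp add: orthogonal_decomposition_def)

lemma component_other:
  assumes "i \<noteq> j" "x \<in> E j"
  shows "component (E i) x = 0"
proof (rule component_unique[OF decomposition_subspace])
  show "(x - 0) \<bullet> e = 0" if "e \<in> E i" for e
  proof -
    have "orthogonal x e" using E assms that unfolding orthogonal_decomposition_def by metis
    then show ?thesis by (simp add: orthogonal_def)
  qed
qed (simp add: decomposition_subspace subspace_0)

text \<open>Both sides are linear in \<open>x\<close> and agree on each \<open>E j\<close>, where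
  all other projections vanish; these subspaces span the space.\<close>

lemma sum_components: "(\<Sum>i\<in>UNIV. component (E i) x) = x"
proof -
  interpret c: linear "component (E i)" for i by (rule linear_component[OF decomposition_subspace])
  have lin: "linear (\<lambda>x. \<Sum>i\<in>UNIV. component (E i) x)"
    by (intro linear_compose_sum ballI linear_component decomposition_subspace)
  have "x \<in> span (\<Union>i. E i)" using E by (simp add: orthogonal_decomposition_def)
  moreover have "(\<Sum>i\<in>UNIV. component (E i) y) = id y" if y: "y \<in> (\<Union>i. E i)" for y
  proof -
    obtain j where j: "y \<in> E j" using y by blast
    have "(\<Sum>i\<in>UNIV. component (E i) y) = (\<Sum>i\<in>UNIV. if i = j then y else 0)"
      by (intro sum.cong refl)
        (simp add: component_other[OF _ j] component_id[OF decomposition_subspace j])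
    then show ?thesis by simp
  qed
  ultimately have "(\<Sum>i\<in>UNIV. component (E i) x) = id x"
    by (rule linear_eq_on[OF lin linear_id])
  then show ?thesis by simp
qed

lemma component_sum:
  assumes "\<And>i. e i \<in> E i"
  shows "component (E j) (\<Sum>i\<in>UNIV. e i) = e j"
proof -
  have "component (E j) (\<Sum>i\<in>UNIV. e i) = (\<Sum>i\<in>UNIV. component (E j) (e i))"
    by (rule linear_sum[OF linear_component[OF decomposition_subspace]])
  also have "\<dots> = (\<Sum>i\<in>UNIV. if i = j then e j else 0)"
    by (intro sum.cong refl)
      (simp add: component_other[OF _ assms] component_id[OF decomposition_subspace assms])
  finally show ?thesis by simp
qed

lemma inner_sum_components: "x \<bullet> y = (\<Sum>i\<in>UNIV. component (E i) x \<bullet> component (E i) y)"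
proof -
  have "x \<bullet> y = (\<Sum>i\<in>UNIV. component (E i) x) \<bullet> y" by (simp only: sum_components)
  also have "\<dots> = (\<Sum>i\<in>UNIV. component (E i) x \<bullet> component (E i) y)"
    unfolding inner_sum_left
    by (intro sum.cong refl component_inner(2)[symmetric] decomposition_subspace component_in)
  finally show ?thesis .
qed

text \<open>From the product to a block, only that block of \<open>x\<close> is varied; from the
  blocks to the product, the finitely many block inequalities are added along the orthogonal
  splitting of the inner product.\<close>

lemma regular_normal_cone_components:
  assumes C: "\<And>i. C i \<subseteq> E i"
  shows "v \<in> regular_normal_cone UNIV {z. \<forall>i. component (E i) z \<in> C i} x \<longleftrightarrow>
    (\<forall>i. component (E i) v \<in> regular_normal_cone (E i) (C i) (component (E i) x))"
    (is "v \<in> regular_normal_cone UNIV ?C x \<longleftrightarrow> ?R")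
proof
  interpret c: linear "component (E i)" for i by (rule linear_component[OF decomposition_subspace])
  assume v: "v \<in> regular_normal_cone UNIV ?C x"
  then have x: "x \<in> ?C" by (auto simp: regular_normal_cone_def split: if_splits)
  show ?R
  proof
    fix i
    have "\<exists>\<delta>>0. \<forall>z\<in>C i. dist z (component (E i) x) < \<delta> \<longrightarrow>
        component (E i) v \<bullet> (z - component (E i) x) \<le> \<epsilon> * norm (z - component (E i) x)"
      if "\<epsilon> > 0" for \<epsilon>
    proof -
      obtain \<delta> where \<delta>: "\<delta> > 0"
        "\<And>z. z \<in> ?C \<Longrightarrow> dist z x < \<delta> \<Longrightarrow> v \<bullet> (z - x) \<le> \<epsilon> * norm (z - x)"
        using regular_normal_coneE[OF v \<open>\<epsilon> > 0\<close>] by blast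
      have "component (E i) v \<bullet> (z - component (E i) x) \<le> \<epsilon> * norm (z - component (E i) x)"
        if z: "z \<in> C i" "dist z (component (E i) x) < \<delta>" for z
      proof -
        \<comment> \<open>Block \<open>i\<close> of \<open>x\<close> is replaced by \<open>z\<close>
          and the other blocks are kept, so \<open>z'\<close> stays in the product set at the same
          distance as in the block.\<close>
        define z' where "z' = x + (z - component (E i) x)"
        have zE: "z - component (E i) x \<in> E i"
          using z(1) C by (intro subspace_diff component_in decomposition_subspace) blast
        have "component (E j) z' = (if j = i then z else component (E j) x)" for j
          using component_other[OF _ zE] component_id[OF decomposition_subspace zE]
          by (auto simp: z'_def c.add)
        then have "z' \<in> ?C" using x z by auto
        then have "v \<bullet> (z' - x) \<le> \<epsilon> * norm (z' - x)"
          using z by (intro \<delta>(2)) (auto simp: z'_def dist_norm)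
        then show ?thesis
          using component_inner(1)[OF decomposition_subspace zE, of v] by (simp add: z'_def)
      qed
      then show ?thesis using \<delta>(1) by blast
    qed
    then show "component (E i) v \<in> regular_normal_cone (E i) (C i) (component (E i) x)"
      using x component_in[OF decomposition_subspace] by (simp add: regular_normal_cone_def)
  qed
next
  interpret c: linear "component (E i)" for i by (rule linear_component[OF decomposition_subspace])
  assume R: ?R
  then have x: "x \<in> ?C" by (auto simp: regular_normal_cone_def split: if_splits)
  have "\<exists>\<delta>>0. \<forall>z\<in>?C. dist z x < \<delta> \<longrightarrow> v \<bullet> (z - x) \<le> \<epsilon> * norm (z - x)" if "\<epsilon> > 0" for \<epsilon>
  proof -
    \<comment> \<open>One inequality per block is summed, so each receives an equal share of
      \<epsilon>.\<close>
    define \<epsilon>' where "\<epsilon>' = \<epsilon> / CARD('i)"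
    have "\<epsilon>' > 0" using that by (simp add: \<epsilon>'_def)
    have "\<exists>\<delta>>0. \<forall>z\<in>C i. dist z (component (E i) x) < \<delta> \<longrightarrow>
        component (E i) v \<bullet> (z - component (E i) x) \<le> \<epsilon>' * norm (z - component (E i) x)" for i
      using R \<open>\<epsilon>' > 0\<close> by (meson regular_normal_coneE)
    then obtain \<delta> where \<delta>: "\<And>i. \<delta> i > 0"
      "\<And>i z. z \<in> C i \<Longrightarrow> dist z (component (E i) x) < \<delta> i \<Longrightarrow>
        component (E i) v \<bullet> (z - component (E i) x) \<le> \<epsilon>' * norm (z - component (E i) x)"
      by metis
    have "v \<bullet> (z - x) \<le> \<epsilon> * norm (z - x)" if z: "z \<in> ?C" "dist z x < Min (range \<delta>)" for z
    proof -
      have "component (E i) v \<bullet> component (E i) (z - x) \<le> \<epsilon>' * norm (z - x)" for i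
      proof -
        have le: "norm (component (E i) (z - x)) \<le> norm (z - x)"
          by (rule norm_component_le[OF decomposition_subspace])
        moreover have "Min (range \<delta>) \<le> \<delta> i" by simp
        ultimately have "dist (component (E i) z) (component (E i) x) < \<delta> i"
          using z(2) unfolding dist_norm c.diff[symmetric] by linarith
        then have "component (E i) v \<bullet> component (E i) (z - x) \<le> \<epsilon>' * norm (component (E i) (z - x))"
          using \<delta>(2)[of "component (E i) z" i] z(1) by (simp add: c.diff)
        also have "\<dots> \<le> \<epsilon>' * norm (z - x)" using le \<open>\<epsilon>' > 0\<close> by simp
        finally show ?thesis .
      qed
      then have "v \<bullet> (z - x) \<le> (\<Sum>i\<in>(UNIV::'i set). \<epsilon>' * norm (z - x))"
        unfolding inner_sum_components[of v] by (intro sum_mono)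
      then show ?thesis by (simp add: \<epsilon>'_def)
    qed
    moreover have "Min (range \<delta>) > 0" using \<delta>(1) by simp
    ultimately show ?thesis by blast
  qed
  then show "v \<in> regular_normal_cone UNIV ?C x" using x by (simp add: regular_normal_cone_def)
qed

text \<open>Projecting the approximating sequences is continuous. Conversely, block sequences can be
  added index by index, since finding limiting normals only asks for one sequence in each block;
  their membership in \<open>E i\<close> lets the projections recover them.\<close>

lemma limiting_normal_cone_components:
  assumes C: "\<And>i. C i \<subseteq> E i"
  shows "v \<in> limiting_normal_cone UNIV {z. \<forall>i. component (E i) z \<in> C i} x \<longleftrightarrow>
    (\<forall>i. component (E i) v \<in> limiting_normal_cone (E i) (C i) (component (E i) x))"
    (is "v \<in> limiting_normal_cone UNIV ?C x \<longleftrightarrow> ?R")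
proof
  assume "v \<in> limiting_normal_cone UNIV ?C x"
  then obtain xs vs where seq: "x \<in> ?C" "xs \<longlonglongrightarrow> x" "vs \<longlonglongrightarrow> v"
    "\<And>k. xs k \<in> ?C" "\<And>k. vs k \<in> regular_normal_cone UNIV ?C (xs k)"
    by (rule limiting_normal_coneE) (rule that)
  show ?R
  proof
    fix i
    note bl = bounded_linear_component[OF decomposition_subspace, of i]
    show "component (E i) v \<in> limiting_normal_cone (E i) (C i) (component (E i) x)"
      using seq(1,4,5) bounded_linear.tendsto[OF bl seq(2)] bounded_linear.tendsto[OF bl seq(3)]
      by (intro limiting_normal_coneI[of _ _ "\<lambda>k. component (E i) (xs k)" "\<lambda>k. component (E i) (vs k)"])
        (auto simp: regular_normal_cone_components[OF C])
  qed
next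
  assume ?R
  then have "\<exists>xs vs. component (E i) x \<in> C i \<and> xs \<longlonglongrightarrow> component (E i) x \<and> vs \<longlonglongrightarrow> component (E i) v \<and>
    (\<forall>k. xs k \<in> C i \<and> vs k \<in> regular_normal_cone (E i) (C i) (xs k))" for i
    by (meson limiting_normal_coneE)
  then obtain xs vs where seq: "\<And>i. component (E i) x \<in> C i" "\<And>i. xs i \<longlonglongrightarrow> component (E i) x"
    "\<And>i. vs i \<longlonglongrightarrow> component (E i) v"
    "\<And>i k. xs i k \<in> C i" "\<And>i k. vs i k \<in> regular_normal_cone (E i) (C i) (xs i k)" by metis
  have vE: "vs i k \<in> E i" for i k
    using seq(5)[of i k] by (auto simp: regular_normal_cone_def split: if_splits)
  have cx: "component (E i) (\<Sum>j\<in>UNIV. xs j k) = xs i k" for i k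
    using component_sum[of "\<lambda>j. xs j k"] seq(4) C by blast
  have cv: "component (E i) (\<Sum>j\<in>UNIV. vs j k) = vs i k" for i k
    using component_sum[of "\<lambda>j. vs j k"] vE by blast
  show "v \<in> limiting_normal_cone UNIV ?C x"
  proof (rule limiting_normal_coneI)
    show "x \<in> ?C" using seq(1) by simp
    show "(\<lambda>k. \<Sum>j\<in>UNIV. xs j k) \<longlonglongrightarrow> x"
      using tendsto_sum[of UNIV xs, OF seq(2)] by (simp only: sum_components)
    show "(\<lambda>k. \<Sum>j\<in>UNIV. vs j k) \<longlonglongrightarrow> v"
      using tendsto_sum[of UNIV vs, OF seq(3)] by (simp only: sum_components)
    show "(\<Sum>j\<in>UNIV. xs j k) \<in> ?C" for k using seq(4) by (simp add: cx)
    show "(\<Sum>j\<in>UNIV. vs j k) \<in> regular_normal_cone UNIV ?C (\<Sum>j\<in>UNIV. xs j k)" for k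
      using seq(5) by (simp add: regular_normal_cone_components[OF C] cx cv)
  qed
qed

end

lemma isometric_limiting_normal_cone:
  fixes i :: "'a::euclidean_space \<Rightarrow> 'b::euclidean_space"
  assumes lin: "linear i" and iso: "\<And>x y. i x \<bullet> i y = x \<bullet> y" and "subspace E" "C \<subseteq> E"
  shows "i v \<in> limiting_normal_cone (i ` E) (i ` C) (i x) \<longleftrightarrow> v \<in> limiting_normal_cone E C x"
proof -
  interpret i: linear i by fact
  have norm_i: "norm (i x) = norm x" for x by (simp add: norm_eq_sqrt_inner iso)
  have dist_i: "dist (i x) (i y) = dist x y" for x y
    using norm_i[of "x - y"] by (simp add: dist_norm i.diff)
  have inj: "i x = i y \<longleftrightarrow> x = y" for x y using dist_i[of x y] by (metis dist_eq_0_iff)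
  have mem: "i x \<in> i ` T \<longleftrightarrow> x \<in> T" for x T using inj by auto
  have inner_i: "i v \<bullet> (i z - i x) = v \<bullet> (z - x)" for v z x by (metis i.diff iso)
  have norm_diff: "norm (i z - i x) = norm (z - x)" for z x by (metis i.diff norm_i)
  have reg: "i v \<in> regular_normal_cone (i ` E) (i ` C) (i x) \<longleftrightarrow> v \<in> regular_normal_cone E C x" for v x
    by (simp add: regular_normal_cone_def mem dist_i inner_i norm_diff)
  have tend: "(\<lambda>k. i (xs k)) \<longlonglongrightarrow> i x \<longleftrightarrow> xs \<longlonglongrightarrow> x" for xs :: "nat \<Rightarrow> 'a" and x
    by (simp add: tendsto_iff dist_i)
  show ?thesis
  proof
    assume "i v \<in> limiting_normal_cone (i ` E) (i ` C) (i x)"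
    then obtain xs vs where seq: "i x \<in> i ` C" "xs \<longlonglongrightarrow> i x" "vs \<longlonglongrightarrow> i v" "\<And>k. xs k \<in> i ` C"
      "\<And>k. vs k \<in> regular_normal_cone (i ` E) (i ` C) (xs k)"
      by (rule limiting_normal_coneE) (rule that)
    \<comment> \<open>Points and normals both lie in images under \<open>i\<close>, so the whole
      approximating sequences can be pulled back.\<close>
    have "\<exists>y\<in>C. xs k = i y" "\<exists>w\<in>E. vs k = i w" for k
      using seq(4,5)[of k] by (auto simp: regular_normal_cone_def split: if_splits)
    then obtain ys ws where "xs = (\<lambda>k. i (ys k))" "vs = (\<lambda>k. i (ws k))" by metis
    then show "v \<in> limiting_normal_cone E C x"
      using seq by (intro limiting_normal_coneI[of _ _ ys ws]) (simp_all add: mem tend reg)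
  next
    assume "v \<in> limiting_normal_cone E C x"
    then obtain xs vs where "x \<in> C" "xs \<longlonglongrightarrow> x" "vs \<longlonglongrightarrow> v" "\<And>k. xs k \<in> C"
      "\<And>k. vs k \<in> regular_normal_cone E C (xs k)"
      by (rule limiting_normal_coneE) (rule that)
    then show "i v \<in> limiting_normal_cone (i ` E) (i ` C) (i x)"
      by (intro limiting_normal_coneI[of _ _ "\<lambda>k. i (xs k)" "\<lambda>k. i (vs k)"]) (simp_all add: mem tend reg)
  qed
qed

text \<open>Two families are kept apart because decisions and multipliers live in different types,
  each with its own orthogonal decomposition.\<close>

definition product_mapping ::
  "('i \<Rightarrow> 'a::euclidean_space set) \<Rightarrow> ('i \<Rightarrow> 'a \<Rightarrow> 'a set) \<Rightarrow> ('j \<Rightarrow> 'b::euclidean_space set) \<Rightarrow> ('j \<Rightarrow> 'b \<Rightarrow> 'b set)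
    \<Rightarrow> 'a \<times> 'b \<Rightarrow> ('a \<times> 'b) set" where
  "product_mapping E M E' N = (\<lambda>(x, y). {(v, u).
     (\<forall>i. component (E i) v \<in> M i (component (E i) x)) \<and>
     (\<forall>j. component (E' j) u \<in> N j (component (E' j) y))})"

lemma mem_product_mapping:
  "(v, u) \<in> product_mapping E M E' N (x, y) \<longleftrightarrow>
     (\<forall>i. component (E i) v \<in> M i (component (E i) x)) \<and>
     (\<forall>j. component (E' j) u \<in> N j (component (E' j) y))"
  by (simp add: product_mapping_def)

lemma closed_gph_product_mapping:
  fixes E :: "'i \<Rightarrow> 'a::euclidean_space set" and E' :: "'j \<Rightarrow> 'b::euclidean_space set"
  assumes E: "\<And>i. subspace (E i)" "\<And>j. subspace (E' j)"
    and closed: "\<And>i. closed (gph (M i))" "\<And>j. closed (gph (N j))"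
  shows "closed (gph (product_mapping E M E' N))"
proof -
  have "gph (product_mapping E M E' N) =
     (\<Inter>i. (\<lambda>z. (component (E i) (fst (fst z)), component (E i) (fst (snd z)))) -` gph (M i)) \<inter>
     (\<Inter>j. (\<lambda>z. (component (E' j) (snd (fst z)), component (E' j) (snd (snd z)))) -` gph (N j))"
    by (auto simp: gph_def product_mapping_def)
  moreover have "closed ((\<lambda>z :: ('a \<times> 'b) \<times> ('a \<times> 'b). (component (E i) (fst (fst z)), component (E i) (fst (snd z)))) -` gph (M i))" for i
    by (intro closed_vimage closed continuous_intros
        bounded_linear.continuous_on[OF bounded_linear_component[OF E(1)]])
  moreover have "closed ((\<lambda>z :: ('a \<times> 'b) \<times> ('a \<times> 'b). (component (E' j) (snd (fst z)), component (E' j) (snd (snd z)))) -` gph (N j))" for j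
    by (intro closed_vimage closed continuous_intros
        bounded_linear.continuous_on[OF bounded_linear_component[OF E(2)]])
  ultimately show ?thesis
    by (simp add: closed_Int closed_INT)
qed

text \<open>Regrouping coordinates turns the graph into a product of the block graphs: each block
  collects the matching components of argument and value. The product rule for limiting normals then
  applies, and the embeddings are removed by isometry.\<close>

lemma coderivative_product_mapping:
  fixes E :: "'i::finite \<Rightarrow> 'a::euclidean_space set" and E' :: "'j::finite \<Rightarrow> 'b::euclidean_space set"
  assumes E: "orthogonal_decomposition E" "orthogonal_decomposition E'"
    and M: "\<And>i. gph (M i) \<subseteq> E i \<times> E i" and N: "\<And>j. gph (N j) \<subseteq> E' j \<times> E' j"
  shows "(a, b) \<in> coderivative UNIV UNIV (product_mapping E M E' N) (x, y) (v, u) (c, d) \<longleftrightarrow>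
    (\<forall>i. component (E i) a \<in> coderivative (E i) (E i) (M i) (component (E i) x) (component (E i) v) (component (E i) c)) \<and>
    (\<forall>j. component (E' j) b \<in> coderivative (E' j) (E' j) (N j) (component (E' j) y) (component (E' j) u) (component (E' j) d))"
proof -
  note E_sub = decomposition_subspace[OF E(1)] and E'_sub = decomposition_subspace[OF E(2)]
  interpret c: linear "component (E i)" for i by (rule linear_component[OF E_sub])
  interpret c': linear "component (E' j)" for j by (rule linear_component[OF E'_sub])
  define \<iota> :: "'a \<times> 'a \<Rightarrow> ('a \<times> 'b) \<times> ('a \<times> 'b)" where "\<iota> = (\<lambda>(x, v). ((x, 0), (v, 0)))"
  define \<iota>' :: "'b \<times> 'b \<Rightarrow> ('a \<times> 'b) \<times> ('a \<times> 'b)" where "\<iota>' = (\<lambda>(y, u). ((0, y), (0, u)))"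
  have lin: "linear \<iota>" "linear \<iota>'" by (auto intro!: linearI simp: \<iota>_def \<iota>'_def)
  have iso: "\<iota> s \<bullet> \<iota> t = s \<bullet> t" "\<iota>' s' \<bullet> \<iota>' t' = s' \<bullet> t'" for s t s' t'
    by (auto simp: \<iota>_def \<iota>'_def split: prod.splits)
  have inj: "inj \<iota>" "inj \<iota>'" by (auto simp: \<iota>_def \<iota>'_def inj_on_def)
  \<comment> \<open>The sum type indexes decision and multiplier blocks together, giving a single
    orthogonal decomposition of the space containing the graph.\<close>
  define D where "D = case_sum (\<lambda>i. \<iota> ` (E i \<times> E i)) (\<lambda>j. \<iota>' ` (E' j \<times> E' j))"
  define C where "C = case_sum (\<lambda>i. \<iota> ` gph (M i)) (\<lambda>j. \<iota>' ` gph (N j))"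
  have D_sub: "subspace (D k)" for k
    by (cases k) (auto simp: D_def intro!: linear_subspace_image lin subspace_Times E_sub E'_sub)
  have compl: "component (D (Inl i)) ((x, y), (v, u)) = \<iota> (component (E i) x, component (E i) v)" for i x y v u
    by (rule component_unique[OF D_sub])
      (auto simp: D_def \<iota>_def component_in[OF E_sub] component_orthogonal[OF E_sub])
  have compr: "component (D (Inr j)) ((x, y), (v, u)) = \<iota>' (component (E' j) y, component (E' j) u)" for j x y v u
    by (rule component_unique[OF D_sub])
      (auto simp: D_def \<iota>'_def component_in[OF E'_sub] component_orthogonal[OF E'_sub])
  have D: "orthogonal_decomposition D"
    unfolding orthogonal_decomposition_def
  proof (intro conjI allI impI ballI D_sub)
    have orth: "s \<bullet> t = 0" if "i \<noteq> i'" "s \<in> E i" "t \<in> E i'" for i i' s t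
      using E(1) that unfolding orthogonal_decomposition_def orthogonal_def by metis
    have orth': "s \<bullet> t = 0" if "j \<noteq> j'" "s \<in> E' j" "t \<in> E' j'" for j j' s t
      using E(2) that unfolding orthogonal_decomposition_def orthogonal_def by metis
    show "orthogonal s t" if "k \<noteq> l" "s \<in> D k" "t \<in> D l" for k l s t
      using that by (cases k; cases l) (auto simp: D_def \<iota>_def \<iota>'_def orthogonal_def orth orth')
    have "z \<in> span (\<Union>k. D k)" for z
    proof -
      obtain x y v u where z: "z = ((x, y), (v, u))" by (metis surj_pair)
      have "z = (\<Sum>i\<in>UNIV. component (D (Inl i)) z) + (\<Sum>j\<in>UNIV. component (D (Inr j)) z)"
        by (simp add: z compl compr \<iota>_def \<iota>'_def prod_eq_iff fst_sum snd_sum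
            sum_components[OF E(1)] sum_components[OF E(2)])
      moreover have "component (D k) z \<in> span (\<Union>k. D k)" for k
        using component_in[OF D_sub, of k z] by (intro span_base) blast
      ultimately show ?thesis by (metis span_add span_sum)
    qed
    then show "span (\<Union>k. D k) = UNIV" by blast
  qed
  have CD: "C k \<subseteq> D k" for k
    by (cases k) (simp_all add: C_def D_def image_mono[OF M] image_mono[OF N])
  have gph_eq: "gph (product_mapping E M E' N) = {z. \<forall>k. component (D k) z \<in> C k}"
  proof -
    have "z \<in> gph (product_mapping E M E' N) \<longleftrightarrow> (\<forall>k. component (D k) z \<in> C k)" for z
    proof -
      obtain x y v u where z: "z = ((x, y), (v, u))" by (metis surj_pair)
      show ?thesis
        by (simp add: z split_sum_all compl compr C_def inj_image_mem_iff[OF inj(1)]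
            inj_image_mem_iff[OF inj(2)] gph_def mem_product_mapping)
    qed
    then show ?thesis by blast
  qed
  have "(a, b) \<in> coderivative UNIV UNIV (product_mapping E M E' N) (x, y) (v, u) (c, d) \<longleftrightarrow>
     ((a, b), (- c, - d)) \<in> limiting_normal_cone UNIV {z. \<forall>k. component (D k) z \<in> C k} ((x, y), (v, u))"
    by (simp add: coderivative_def gph_eq)
  also have "\<dots> \<longleftrightarrow> (\<forall>k. component (D k) ((a, b), (- c, - d))
      \<in> limiting_normal_cone (D k) (C k) (component (D k) ((x, y), (v, u))))"
    by (rule limiting_normal_cone_components[OF D CD])
  \<comment> \<open>\<open>D\<close> is unfolded only at the end, since the projection formulas
    \<open>compl\<close> and \<open>compr\<close> are stated for its folded form.\<close>
  also have "\<dots> \<longleftrightarrow>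
     (\<forall>i. \<iota> (component (E i) a, - component (E i) c) \<in>
        limiting_normal_cone (\<iota> ` (E i \<times> E i)) (\<iota> ` gph (M i)) (\<iota> (component (E i) x, component (E i) v))) \<and>
     (\<forall>j. \<iota>' (component (E' j) b, - component (E' j) d) \<in>
        limiting_normal_cone (\<iota>' ` (E' j \<times> E' j)) (\<iota>' ` gph (N j)) (\<iota>' (component (E' j) y, component (E' j) u)))"
    by (simp add: split_sum_all compl compr C_def c.neg c'.neg) (simp add: D_def)
  also have "\<dots> \<longleftrightarrow>
    (\<forall>i. component (E i) a \<in> coderivative (E i) (E i) (M i) (component (E i) x) (component (E i) v) (component (E i) c)) \<and>
    (\<forall>j. component (E' j) b \<in> coderivative (E' j) (E' j) (N j) (component (E' j) y) (component (E' j) u) (component (E' j) d))"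
    using isometric_limiting_normal_cone[OF lin(1) iso(1) subspace_Times[OF E_sub E_sub] M]
      isometric_limiting_normal_cone[OF lin(2) iso(2) subspace_Times[OF E'_sub E'_sub] N]
    by (simp add: coderivative_def)
  finally show ?thesis .
qed

text \<open>For each fixed \<open>z\<close> the defining inequality is continuous jointly in the
  base point and the normal. Closedness of the graph is what later provides minimisers.\<close>

lemma closed_gph_convex_normal_cone:
  assumes "closed E" "closed C"
  shows "closed (gph (convex_normal_cone E C))"
proof -
  have "gph (convex_normal_cone E C) = (C \<times> E) \<inter> {p. \<forall>z\<in>C. snd p \<bullet> (z - fst p) \<le> 0}"
    by (auto simp: gph_def convex_normal_cone_def split: if_splits)
  moreover have "closed {p :: 'a \<times> 'a. \<forall>z\<in>C. snd p \<bullet> (z - fst p) \<le> 0}"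
    unfolding Ball_def imp_conv_disj
    by (intro closed_Collect_all closed_Collect_disj closed_Collect_const closed_Collect_le continuous_intros)
  ultimately show ?thesis using assms by (simp add: closed_Int closed_Times)
qed

lemma gph_convex_normal_cone_subset: "C \<subseteq> E \<Longrightarrow> gph (convex_normal_cone E C) \<subseteq> E \<times> E"
  by (auto simp: gph_def convex_normal_cone_def split: if_splits)

lemma closed_polar_cone: "subspace E \<Longrightarrow> closed (polar_cone E K)"
proof -
  assume "subspace E"
  have "polar_cone E K = E \<inter> {y. \<forall>k\<in>K. y \<bullet> k \<le> 0}" by (auto simp: polar_cone_def)
  moreover have "closed {y::'a. \<forall>k\<in>K. y \<bullet> k \<le> 0}"
    unfolding Ball_def imp_conv_disj
    by (intro closed_Collect_all closed_Collect_disj closed_Collect_const closed_Collect_le continuous_intros)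
  ultimately show ?thesis using \<open>subspace E\<close> by (simp add: closed_Int closed_subspace)
qed

section \<open>Coordinate blocks of the decision space\<close>

lemma subspace_block_space: "subspace (block_space owner \<nu>)"
  by (auto simp: block_space_def subspace_def)

text \<open>Identifies coordinate truncation with orthogonal projection, so that the general results
  on decompositions apply to the decision blocks.\<close>

lemma component_block_space: "component (block_space owner \<nu>) = block owner \<nu>"
proof
  fix x :: "real^'a"
  show "component (block_space owner \<nu>) x = block owner \<nu> x"
    by (rule component_unique[OF subspace_block_space])
      (auto simp: block_space_def block_def inner_vec_def intro!: sum.neutral)
qed

lemma linear_block: "linear (block owner \<nu>)"
  using linear_component[OF subspace_block_space, of owner \<nu>] by (simp add: component_block_space)

lemma bounded_linear_block: "bounded_linear (block owner \<nu>)"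
  using linear_block by (simp add: linear_conv_bounded_linear)

lemma block_block: "block owner \<nu> (block owner \<nu> x) = block owner \<nu> x"
  by (simp add: block_def vec_eq_iff)

lemma block_inner: "block owner \<nu> x \<bullet> y = x \<bullet> block owner \<nu> y"
  using component_sym[OF subspace_block_space, of owner \<nu>] by (simp add: component_block_space)

lemma block_in: "block owner \<nu> x \<in> block_space owner \<nu>"
  by (simp add: block_def block_space_def)

text \<open>Every coordinate vector lies in the block of its owner, so the blocks span; a player
  owning no coordinate merely contributes the zero space.\<close>

lemma orthogonal_decomposition_block_space:
  fixes owner :: "'n::finite \<Rightarrow> 'p"
  shows "orthogonal_decomposition (block_space owner)"
  unfolding orthogonal_decomposition_def
proof (intro conjI allI impI ballI subspace_block_space)
  show "orthogonal a b" if "\<nu> \<noteq> \<mu>" "a \<in> block_space owner \<nu>" "b \<in> block_space owner \<mu>" for \<nu> \<mu> a b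
    unfolding orthogonal_def inner_vec_def
    using that by (intro sum.neutral) (auto simp: block_space_def)
  have "axis i (1::real) \<in> (\<Union>\<nu>. block_space owner \<nu>)" for i
    by (auto simp: block_space_def axis_def intro!: exI[of _ "owner i"])
  then have "Basis \<subseteq> (\<Union>\<nu>. block_space owner \<nu>)" by (auto simp: Basis_vec_def)
  then have "span Basis \<subseteq> span (\<Union>\<nu>. block_space owner \<nu>)" by (rule span_mono)
  then show "span (\<Union>\<nu>. block_space owner \<nu>) = UNIV" by auto
qed

section \<open>Gradients and partial derivatives\<close>

lemma gradient_eq:
  assumes "(h has_derivative (\<lambda>k. k \<bullet> d)) (at x)"
  shows "gradient h x = d"
  unfolding gradient_def
proof (rule the_equality)
  show "GDERIV h x :> d" using assms by (simp add: gderiv_def)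
  fix d' assume "GDERIV h x :> d'"
  then have "(\<lambda>k. k \<bullet> d') = (\<lambda>k. k \<bullet> d)"
    unfolding gderiv_def using assms by (rule has_derivative_unique)
  then show "d' = d" by (metis vector_eq_ldot)
qed

text \<open>The representing vector of the derivative is its adjoint evaluated at \<open>1\<close>;
  uniqueness identifies it with \<open>gradient\<close>.\<close>

lemma gradient_has_derivative:
  assumes "h differentiable (at x)"
  shows "(h has_derivative (\<lambda>k. k \<bullet> gradient h x)) (at x)"
proof -
  obtain h' where h': "(h has_derivative h') (at x)" using assms by (auto simp: differentiable_def)
  then have "linear h'" using has_derivative_linear by blast
  then have "h' = (\<lambda>k. k \<bullet> adjoint h' 1)" using adjoint_works[of h' _ 1] by auto
  then show ?thesis using h' gradient_eq by metis
qed

text \<open>\<open>Blinfun\<close> is inverted by \<open>blinfun_apply\<close> on bounded linear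
  maps, which differentiability guarantees here.\<close>

lemma deriv_x_has_derivative:
  fixes G :: "'a::euclidean_space \<times> 'd \<Rightarrow> 'b::euclidean_space"
  assumes "(\<lambda>z. G (z, w)) differentiable (at x)"
  shows "((\<lambda>z. G (z, w)) has_derivative blinfun_apply (deriv_x G (x, w))) (at x)"
    and "blinfun_apply (deriv_x G (x, w)) = frechet_derivative (\<lambda>z. G (z, w)) (at x)"
proof -
  have d: "((\<lambda>z. G (z, w)) has_derivative frechet_derivative (\<lambda>z. G (z, w)) (at x)) (at x)"
    using assms by (simp add: frechet_derivative_works)
  show eq: "blinfun_apply (deriv_x G (x, w)) = frechet_derivative (\<lambda>z. G (z, w)) (at x)"
    using bounded_linear_Blinfun_apply[OF has_derivative_bounded_linear[OF d]] by (simp add: deriv_x_def)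
  show "((\<lambda>z. G (z, w)) has_derivative blinfun_apply (deriv_x G (x, w))) (at x)"
    using d by (simp add: eq)
qed

section \<open>The optimality system of the game\<close>

text \<open>Chain rule along \<open>x + block owner \<nu> h\<close> at \<open>h = 0\<close>. The
  block projection is self-adjoint and therefore reappears in front of each gradient term.\<close>

lemma partial_gradient_lagrangian:
  fixes f :: "'p \<Rightarrow> (real^'n) \<times> 'd \<Rightarrow> real" and F :: "'p \<Rightarrow> (real^'n) \<times> 'd \<Rightarrow> 'y::euclidean_space"
    and owner :: "'n::finite \<Rightarrow> 'p"
  assumes "(\<lambda>z. f \<nu> (z, w)) differentiable (at x)"
    and "(\<lambda>z. F \<nu> (z, w)) differentiable (at (block owner \<nu> x))"
  shows "partial_gradient owner \<nu> (\<lambda>z. lagrangian owner f F \<nu> z \<eta> w \<xi> \<upsilon>) x =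
    block owner \<nu> (grad_x (f \<nu>) (x, w))
    + block owner \<nu> (adjoint (blinfun_apply (deriv_x (F \<nu>) (block owner \<nu> x, w))) \<eta>) - block owner \<nu> \<xi>"
    (is "_ = ?g")
  unfolding partial_gradient_def
proof (rule gradient_eq)
  let ?P = "block owner \<nu>"
  let ?D = "blinfun_apply (deriv_x (F \<nu>) (?P x, w))"
  interpret P: linear ?P by (rule linear_block)
  have P0: "?P 0 = 0" by (rule P.zero)
  have shift: "((\<lambda>h. x + ?P h) has_derivative ?P) (at 0)"
    using has_derivative_add[OF has_derivative_const bounded_linear_imp_has_derivative[OF bounded_linear_block]]
    by simp
  have Pshift: "?P (x + ?P h) = ?P x + ?P h" for h by (simp add: P.add block_block)
  have shift': "((\<lambda>h. ?P (x + ?P h)) has_derivative ?P) (at 0)"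
    unfolding Pshift
    using has_derivative_add[OF has_derivative_const bounded_linear_imp_has_derivative[OF bounded_linear_block]]
    by simp
  have f: "((\<lambda>h. f \<nu> (x + ?P h, w)) has_derivative (\<lambda>h. ?P h \<bullet> grad_x (f \<nu>) (x, w))) (at 0)"
    using has_derivative_compose[OF shift, of "\<lambda>z. f \<nu> (z, w)" "\<lambda>k. k \<bullet> grad_x (f \<nu>) (x, w)"]
      gradient_has_derivative[OF assms(1)] by (simp add: P0 grad_x_def)
  have F: "((\<lambda>h. F \<nu> (?P (x + ?P h), w)) has_derivative (\<lambda>h. ?D (?P h))) (at 0)"
    using has_derivative_compose[OF shift', of "\<lambda>z. F \<nu> (z, w)" ?D]
      deriv_x_has_derivative(1)[where G = "F \<nu>", OF assms(2)] by (simp add: P0)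
  have "((\<lambda>h. lagrangian owner f F \<nu> (x + ?P h) \<eta> w \<xi> \<upsilon>) has_derivative
      (\<lambda>h. ?P h \<bullet> grad_x (f \<nu>) (x, w) - \<xi> \<bullet> ?P h + \<eta> \<bullet> (?D (?P h) - 0))) (at 0)"
    unfolding lagrangian_def
    by (intro has_derivative_add has_derivative_diff f F has_derivative_const
        has_derivative_inner_right shift')
  moreover have "?P h \<bullet> grad_x (f \<nu>) (x, w) - \<xi> \<bullet> ?P h + \<eta> \<bullet> (?D (?P h) - 0) = h \<bullet> ?g" for h
  proof -
    have "linear ?D" by (simp add: blinfun.bounded_linear_right bounded_linear.linear)
    then have "\<eta> \<bullet> ?D (?P h) = ?P h \<bullet> adjoint ?D \<eta>" by (metis adjoint_works inner_commute)
    moreover have "\<xi> \<bullet> ?P h = h \<bullet> ?P \<xi>" by (metis block_inner inner_commute)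
    ultimately show ?thesis by (simp add: inner_add_right inner_diff_right block_inner)
  qed
  ultimately show "((\<lambda>h. lagrangian owner f F \<nu> (x + ?P h) \<eta> w \<xi> \<upsilon>) has_derivative (\<lambda>h. h \<bullet> ?g)) (at 0)"
    by simp
qed

lemma ref_lagrangian_eq: "ref_lagrangian owner f F w \<nu> x \<eta> = lagrangian owner f F \<nu> x \<eta> w 0 0"
  by (simp add: ref_lagrangian_def lagrangian_def)

text \<open>One neighbourhood \<open>U\<close> in the full variables serves all players; the
  conditions on a player's constraint are evaluated at the player's own block.\<close>

locale smooth_game =
  fixes owner :: "'n::finite \<Rightarrow> 'p::finite"
    and Y :: "'p \<Rightarrow> 'y::euclidean_space set"
    and f :: "'p \<Rightarrow> (real^'n) \<times> 'd::real_normed_vector \<Rightarrow> real"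
    and F :: "'p \<Rightarrow> (real^'n) \<times> 'd \<Rightarrow> 'y"
    and wbar :: 'd and xbar :: "real^'n" and ybar :: 'y
    and U :: "((real^'n) \<times> 'd) set"
  assumes Y: "orthogonal_decomposition Y"
    and F_own: "\<And>\<nu> x w. F \<nu> (x, w) = F \<nu> (block owner \<nu> x, w)"
    and F_range: "\<And>\<nu> x w. F \<nu> (x, w) \<in> Y \<nu>"
    and U: "open U" "(xbar, wbar) \<in> U"
    and f_diff: "\<And>\<nu> x w. (x, w) \<in> U \<Longrightarrow> (\<lambda>z. f \<nu> (z, w)) differentiable (at x)"
    and f_strict: "\<And>\<nu> x w. (x, w) \<in> U \<Longrightarrow> strictly_differentiable_at (grad_x (f \<nu>)) (x, w)"
    and F_diff: "\<And>\<nu> x w. (x, w) \<in> U \<Longrightarrow> (\<lambda>z. F \<nu> (z, w)) differentiable (at (block owner \<nu> x))"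
    and F_strict: "\<And>\<nu> x w. (x, w) \<in> U \<Longrightarrow> strictly_differentiable_at (F \<nu>) (block owner \<nu> x, w)"
    and dF_strict: "\<And>\<nu> x w. (x, w) \<in> U \<Longrightarrow> strictly_differentiable_at (deriv_x (F \<nu>)) (block owner \<nu> x, w)"
begin

text \<open>On \<open>U\<close> this is the gradient of the Lagrangian in block \<nu> for zero tilt.
  The closed form exhibits it as a combination of strictly differentiable maps.\<close>

definition own_gradient :: "'p \<Rightarrow> 'd \<Rightarrow> (real^'n) \<times> 'y \<Rightarrow> real^'n" where
  "own_gradient \<nu> w = (\<lambda>(x, y). block owner \<nu> (grad_x (f \<nu>) (x, w))
    + block owner \<nu> (adjoint (blinfun_apply (deriv_x (F \<nu>) (block owner \<nu> x, w))) (component (Y \<nu>) y)))"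

text \<open>The signs are chosen so that the optimality system says that the residual is normal:
  stationarity becomes \<open>v\<close> minus the gradient in the normal cone of
  \<open>X \<nu>\<close>, and the multiplier condition becomes \<open>F - u\<close> in the normal
  cone of the polar. The sums reassemble mutually orthogonal blocks.\<close>

definition residual :: "('d \<times> (real^'n) \<times> 'y) \<times> ((real^'n) \<times> 'y) \<Rightarrow> (real^'n) \<times> 'y" where
  "residual = (\<lambda>((w, v, u), z).
     (v - (\<Sum>\<nu>\<in>UNIV. own_gradient \<nu> w z), (\<Sum>\<nu>\<in>UNIV. F \<nu> (block owner \<nu> (fst z), w)) - u))"

lemma Y_sub: "subspace (Y \<nu>)"
  by (rule decomposition_subspace[OF Y])

lemma block_own_gradient: "block owner \<nu> (own_gradient \<nu> w z) = own_gradient \<nu> w z"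
  by (simp add: own_gradient_def linear_add[OF linear_block] block_block split: prod.splits)

lemma own_gradient_in: "own_gradient \<nu> w z \<in> block_space owner \<nu>"
  by (metis block_own_gradient block_in)

lemma partial_gradient_eq:
  assumes "(x, w) \<in> U"
  shows "partial_gradient owner \<nu> (\<lambda>z. lagrangian owner f F \<nu> z (component (Y \<nu>) y) w (block owner \<nu> v) \<upsilon>) x
    = own_gradient \<nu> w (x, y) - block owner \<nu> v"
  using partial_gradient_lagrangian[where f = f and F = F and \<nu> = \<nu>, OF f_diff[OF assms] F_diff[OF assms]]
  by (simp add: own_gradient_def block_block)

lemma block_residual: "block owner \<nu> (fst (residual ((w, v, u), z))) = block owner \<nu> v - own_gradient \<nu> w z"
  using component_sum[OF orthogonal_decomposition_block_space, of "\<lambda>\<mu>. own_gradient \<mu> w z", OF own_gradient_in]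
  by (simp add: residual_def linear_diff[OF linear_block] component_block_space)

lemma component_residual:
  "component (Y \<nu>) (snd (residual ((w, v, u), z))) = F \<nu> (block owner \<nu> (fst z), w) - component (Y \<nu>) u"
proof -
  have "component (Y \<nu>) (\<Sum>\<mu>\<in>UNIV. F \<mu> (block owner \<mu> (fst z), w)) = F \<nu> (block owner \<nu> (fst z), w)"
    by (rule component_sum[OF Y F_range])
  then show ?thesis by (simp add: residual_def linear_diff[OF linear_component[OF Y_sub]])
qed

text \<open>Each inclusion \<open>0 \<in> a +o C\<close> is the membership
  \<open>- a \<in> C\<close>, and \<open>- a\<close> is the corresponding block of the
  residual.\<close>

lemma S_Lag_iff_residual:
  assumes "(x, w) \<in> U"
  shows "(x, y) \<in> S_Lag owner Y X K f F (w, v, u) \<longleftrightarrow>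
    residual ((w, v, u), (x, y)) \<in> product_mapping
      (block_space owner) (\<lambda>\<nu>. convex_normal_cone (block_space owner \<nu>) (X \<nu>))
      Y (\<lambda>\<nu>. convex_normal_cone (Y \<nu>) (polar_cone (Y \<nu>) (K \<nu>))) (x, y)"
proof -
  have zero: "0 \<in> a +o C \<longleftrightarrow> - a \<in> C" for a :: "'v::ab_group_add" and C
    by (simp add: elt_set_plus_def eq_commute[of 0] add_eq_0_iff)
  obtain r1 r2 where r: "residual ((w, v, u), (x, y)) = (r1, r2)" by (cases "residual ((w, v, u), (x, y))")
  have "block owner \<nu> r1 = block owner \<nu> v - own_gradient \<nu> w (x, y)" for \<nu>
    using block_residual[of \<nu> w v u "(x, y)"] r by simp
  moreover have "component (Y \<nu>) r2 = F \<nu> (block owner \<nu> x, w) - component (Y \<nu>) u" for \<nu>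
    using component_residual[of \<nu> w v u "(x, y)"] r by simp
  ultimately show ?thesis
    by (simp add: S_Lag_def r mem_product_mapping component_block_space partial_gradient_eq[OF assms]
        zero all_conj_distrib)
qed

lemma linear_xw: "bounded_linear (\<lambda>c :: ('d \<times> (real^'n) \<times> 'y) \<times> ((real^'n) \<times> 'y). (fst (snd c), fst (fst c)))"
  by (intro bounded_linear_intros)

lemma linear_blockxw:
  "bounded_linear (\<lambda>c :: ('d \<times> (real^'n) \<times> 'y) \<times> ((real^'n) \<times> 'y). (block owner \<nu> (fst (snd c)), fst (fst c)))"
  by (intro bounded_linear_intros bounded_linear_compose[OF bounded_linear_block])

lemma own_gradient_strict:
  assumes "(fst (snd c), fst (fst c)) \<in> U"
  shows "strictly_differentiable_at (\<lambda>c :: ('d \<times> (real^'n) \<times> 'y) \<times> ((real^'n) \<times> 'y). own_gradient \<nu> (fst (fst c)) (snd c)) c"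
proof -
  have 1: "strictly_differentiable_at (\<lambda>c :: ('d \<times> (real^'n) \<times> 'y) \<times> ((real^'n) \<times> 'y).
      block owner \<nu> (grad_x (f \<nu>) (fst (snd c), fst (fst c)))) c"
    by (rule strictly_differentiable_linear_compose[OF bounded_linear_block
        strictly_differentiable_compose[OF strictly_differentiable_linear[OF linear_xw] f_strict[OF assms]]])
  have "strictly_differentiable_at (\<lambda>c :: ('d \<times> (real^'n) \<times> 'y) \<times> ((real^'n) \<times> 'y).
      (\<lambda>(D, y). adjoint (blinfun_apply D) y)
        (deriv_x (F \<nu>) (block owner \<nu> (fst (snd c)), fst (fst c)), component (Y \<nu>) (snd (snd c)))) c"
    by (rule strictly_differentiable_compose[OF strictly_differentiable_Pair[OF
          strictly_differentiable_compose[OF strictly_differentiable_linear[OF linear_blockxw] dF_strict[OF assms]]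
          strictly_differentiable_linear]
        strictly_differentiable_bilinear[OF bounded_bilinear_adjoint]])
      (intro bounded_linear_compose[OF bounded_linear_component[OF Y_sub]] bounded_linear_intros)
  then have 2: "strictly_differentiable_at (\<lambda>c :: ('d \<times> (real^'n) \<times> 'y) \<times> ((real^'n) \<times> 'y).
      adjoint (blinfun_apply (deriv_x (F \<nu>) (block owner \<nu> (fst (snd c)), fst (fst c))))
        (component (Y \<nu>) (snd (snd c)))) c"
    by simp
  show ?thesis
    using strictly_differentiable_add[OF 1 strictly_differentiable_linear_compose[OF bounded_linear_block 2]]
    by (simp add: own_gradient_def case_prod_beta)
qed

lemma residual_strict:
  assumes "(fst (snd c), fst (fst c)) \<in> U"
  shows "strictly_differentiable_at residual c"
proof -
  have "strictly_differentiable_at (\<lambda>c :: ('d \<times> (real^'n) \<times> 'y) \<times> ((real^'n) \<times> 'y).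
      (fst (snd (fst c)) - (\<Sum>\<nu>\<in>UNIV. own_gradient \<nu> (fst (fst c)) (snd c)),
       (\<Sum>\<nu>\<in>UNIV. F \<nu> (block owner \<nu> (fst (snd c)), fst (fst c))) - snd (snd (fst c)))) c"
    by (intro strictly_differentiable_Pair strictly_differentiable_diff strictly_differentiable_sum
        own_gradient_strict assms finite
        strictly_differentiable_compose[OF strictly_differentiable_linear[OF linear_blockxw] F_strict[OF assms]]
        strictly_differentiable_linear) (intro bounded_linear_intros)+
  then show ?thesis by (simp add: residual_def case_prod_beta')
qed

abbreviation own_derivative :: "'p \<Rightarrow> real^'n \<Rightarrow> 'y" where
  "own_derivative \<nu> \<equiv> frechet_derivative (\<lambda>z. F \<nu> (z, wbar)) (at (block owner \<nu> xbar))"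

lemma own_derivative: "((\<lambda>z. F \<nu> (z, wbar)) has_derivative own_derivative \<nu>) (at (block owner \<nu> xbar))"
  using F_diff[OF U(2)] by (simp add: frechet_derivative_works)

lemma deriv_x_eq: "blinfun_apply (deriv_x (F \<nu>) (block owner \<nu> xbar, wbar)) = own_derivative \<nu>"
  by (rule deriv_x_has_derivative(2)[OF F_diff[OF U(2)]])

lemma linear_own_derivative: "linear (own_derivative \<nu>)"
  using has_derivative_linear[OF own_derivative] .

text \<open>The constraint factors through the block projection; the chain rule and uniqueness of
  derivatives transfer this to its derivative.\<close>

lemma own_derivative_block: "own_derivative \<nu> (block owner \<nu> h) = own_derivative \<nu> h"
proof -
  have "((\<lambda>z. F \<nu> (z, wbar)) has_derivative own_derivative \<nu>) (at (block owner \<nu> (block owner \<nu> xbar)))"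
    unfolding block_block by (rule own_derivative)
  from has_derivative_compose[OF bounded_linear_imp_has_derivative[OF bounded_linear_block] this]
  have "((\<lambda>z. F \<nu> (z, wbar)) has_derivative (\<lambda>h. own_derivative \<nu> (block owner \<nu> h)))
      (at (block owner \<nu> xbar))" unfolding F_own[symmetric] .
  then have "(\<lambda>h. own_derivative \<nu> (block owner \<nu> h)) = own_derivative \<nu>"
    by (rule has_derivative_unique[OF _ own_derivative])
  then show ?thesis by metis
qed

text \<open>Projecting onto \<open>Y \<nu>\<close> leaves the constraint unchanged, hence also its
  derivative.\<close>

lemma own_derivative_in: "own_derivative \<nu> h \<in> Y \<nu>"
proof -
  have "((\<lambda>z. component (Y \<nu>) (F \<nu> (z, wbar))) has_derivative (\<lambda>h. component (Y \<nu>) (own_derivative \<nu> h)))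
      (at (block owner \<nu> xbar))"
    by (rule bounded_linear.has_derivative[OF bounded_linear_component[OF Y_sub] own_derivative])
  then have "(\<lambda>h. component (Y \<nu>) (own_derivative \<nu> h)) = own_derivative \<nu>"
    unfolding component_id[OF Y_sub F_range] by (rule has_derivative_unique[OF _ own_derivative])
  then show ?thesis by (metis component_in[OF Y_sub])
qed

lemma adjoint_own_derivative: "h \<bullet> adjoint (own_derivative \<nu>) y = own_derivative \<nu> h \<bullet> y"
  by (rule adjoint_works[OF linear_own_derivative])

lemma block_adjoint_own_derivative: "block owner \<nu> (adjoint (own_derivative \<nu>) y) = adjoint (own_derivative \<nu>) y"
proof -
  have "h \<bullet> block owner \<nu> (adjoint (own_derivative \<nu>) y) = h \<bullet> adjoint (own_derivative \<nu>) y" for h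
    by (simp add: adjoint_own_derivative own_derivative_block flip: block_inner)
  then show ?thesis using vector_eq_ldot by blast
qed

text \<open>Ensures that the derivative chosen in \<open>game_hessian\<close> is a genuine one: the
  partial gradient coincides with \<open>own_gradient\<close> on a neighbourhood of
  \<open>xbar\<close>, and the latter is differentiable.\<close>

lemma own_gradient_x_derivative:
  obtains A where "((\<lambda>x. own_gradient \<nu> wbar (x, ybar)) has_derivative A) (at xbar)"
    "frechet_derivative (partial_gradient owner \<nu>
      (\<lambda>z. ref_lagrangian owner f F wbar \<nu> z (component (Y \<nu>) ybar))) (at xbar) = A"
    "\<And>h. block owner \<nu> (A h) = A h"
proof -
  let ?c = "\<lambda>x. ((wbar, 0 :: real^'n, 0 :: 'y), (x, ybar))"
  have "(fst (snd (?c xbar)), fst (fst (?c xbar))) \<in> U" using U(2) by simp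
  then obtain D where D: "((\<lambda>c :: ('d \<times> (real^'n) \<times> 'y) \<times> ((real^'n) \<times> 'y).
      own_gradient \<nu> (fst (fst c)) (snd c)) has_derivative D) (at (?c xbar))"
    using strictly_differentiable_imp_differentiable[OF own_gradient_strict]
    unfolding differentiable_def by blast
  have "(?c has_derivative (\<lambda>h. (0, (h, 0)))) (at xbar)"
    by (auto intro!: derivative_eq_intros simp: zero_prod_def)
  from has_derivative_compose[OF this D]
  obtain A where A: "((\<lambda>x. own_gradient \<nu> wbar (x, ybar)) has_derivative A) (at xbar)" by simp
  have "open {x. (x, wbar) \<in> U}"
    using open_vimage[OF U(1), of "\<lambda>x. (x, wbar)"] by (simp add: vimage_def continuous_intros)
  then have "(partial_gradient owner \<nu>
      (\<lambda>z. ref_lagrangian owner f F wbar \<nu> z (component (Y \<nu>) ybar)) has_derivative A) (at xbar)"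
    by (rule has_derivative_transform_within_open[OF A])
      (use U(2) partial_gradient_eq[of _ wbar \<nu> ybar 0] in \<open>simp_all add: ref_lagrangian_eq linear_0[OF linear_block]\<close>)
  moreover have "block owner \<nu> (A h) = A h" for h
  proof -
    have "((\<lambda>x. block owner \<nu> (own_gradient \<nu> wbar (x, ybar))) has_derivative (\<lambda>h. block owner \<nu> (A h))) (at xbar)"
      by (rule bounded_linear.has_derivative[OF bounded_linear_block A])
    then have "(\<lambda>h. block owner \<nu> (A h)) = A"
      unfolding block_own_gradient by (rule has_derivative_unique[OF _ A])
    then show ?thesis by metis
  qed
  ultimately show thesis using that A frechet_derivative_at by metis
qed

abbreviation hessian :: "real^'n^'n" where "hessian \<equiv> game_hessian owner Y f F wbar xbar ybar"

text \<open>Row \<open>i\<close> of the matrix records the derivative of the gradient of player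
  \<open>owner i\<close> only. The other players' derivatives stay in their own blocks and vanish in
  entry \<open>i\<close>, so the sum over all players reproduces that row.\<close>

lemma game_hessian_derivative:
  "((\<lambda>x. \<Sum>\<nu>\<in>UNIV. own_gradient \<nu> wbar (x, ybar)) has_derivative (\<lambda>h. hessian *v h)) (at xbar)"
proof -
  define A where "A \<nu> = frechet_derivative (partial_gradient owner \<nu>
      (\<lambda>z. ref_lagrangian owner f F wbar \<nu> z (component (Y \<nu>) ybar))) (at xbar)" for \<nu>
  have A: "((\<lambda>x. own_gradient \<nu> wbar (x, ybar)) has_derivative A \<nu>) (at xbar)"
    "block owner \<nu> (A \<nu> h) = A \<nu> h" for \<nu> h
    unfolding A_def by (rule own_gradient_x_derivative[of \<nu>], simp, rule own_gradient_x_derivative[of \<nu>], simp)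
  have "hessian *v h = (\<Sum>\<nu>\<in>UNIV. A \<nu> h)" for h
  proof (rule vec_eq_iff[THEN iffD2], rule allI)
    fix i
    have zero: "A \<nu> h $ i = 0" if "\<nu> \<noteq> owner i" for \<nu>
    proof -
      have "A \<nu> h $ i = block owner \<nu> (A \<nu> h) $ i" by (simp only: A(2))
      then show ?thesis using that by (simp add: block_def)
    qed
    have lin: "linear (A (owner i))" using A(1) by (rule has_derivative_linear)
    have "(hessian *v h) $ i = (\<Sum>j\<in>UNIV. A (owner i) (axis j 1) $ i * h $ j)"
      by (simp add: matrix_vector_mult_def game_hessian_def A_def)
    also have "\<dots> = A (owner i) (\<Sum>j\<in>UNIV. h $ j *\<^sub>R axis j 1) $ i"
      by (simp add: linear_sum[OF lin] linear_cmul[OF lin] mult.commute)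
    also have "(\<Sum>j\<in>UNIV. h $ j *\<^sub>R axis j 1) = h"
      using basis_expansion[of h] by (simp add: scalar_mult_eq_scaleR)
    also have "A (owner i) h $ i = (\<Sum>\<nu>\<in>UNIV. if \<nu> = owner i then A (owner i) h $ i else 0)" by simp
    also have "\<dots> = (\<Sum>\<nu>\<in>UNIV. A \<nu> h) $ i"
      unfolding sum_component by (intro sum.cong) (auto simp: zero)
    finally show "(hessian *v h) $ i = (\<Sum>\<nu>\<in>UNIV. A \<nu> h) $ i" .
  qed
  then show ?thesis using has_derivative_sum[of UNIV, OF A(1)] by simp
qed

text \<open>The adjoint is stated at \<open>(- w1, - w2)\<close> because that is the substitution
  bringing the kernel condition into the required form; the minus signs cancel those in front of the
  gradient and reverse that of the constraint derivative's adjoint.\<close>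

lemma residual_derivative:
  obtains B where "((\<lambda>z. residual ((wbar, 0, 0), z)) has_derivative B) (at (xbar, ybar))"
    "\<And>w1 w2. adjoint B (- w1, - w2) =
      (transpose hessian *v w1 - (\<Sum>\<nu>\<in>UNIV. adjoint (own_derivative \<nu>) (component (Y \<nu>) w2)),
       \<Sum>\<nu>\<in>UNIV. own_derivative \<nu> (block owner \<nu> w1))"
proof -
  have "residual differentiable (at ((wbar, 0, 0), (xbar, ybar)))"
    using U(2) by (intro strictly_differentiable_imp_differentiable residual_strict) simp
  then obtain D where D: "(residual has_derivative D) (at ((wbar, 0, 0), (xbar, ybar)))"
    by (auto simp: differentiable_def)
  define B where "B z = D (0, z)" for z
  have B: "((\<lambda>z. residual ((wbar, 0, 0), z)) has_derivative B) (at (xbar, ybar))"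
  proof -
    have "((\<lambda>z. ((wbar, 0 :: real^'n, 0 :: 'y), z)) has_derivative (\<lambda>h. (0, h))) (at (xbar, ybar))"
      by (auto intro!: derivative_eq_intros)
    from has_derivative_compose[OF this D] show ?thesis by (simp add: B_def[abs_def])
  qed
  interpret B: bounded_linear B using B by (rule has_derivative_bounded_linear)
  \<comment> \<open>Once the joint derivative exists, linearity allows it to be computed from the
    partial derivatives in \<open>x\<close> and in \<open>y\<close> separately.\<close>
  have Bx: "B (h, 0) = (- (hessian *v h), \<Sum>\<nu>\<in>UNIV. own_derivative \<nu> h)" for h
  proof -
    have "((\<lambda>x. (x, ybar)) has_derivative (\<lambda>h. (h, 0))) (at xbar)"
      by (auto intro!: derivative_eq_intros)
    from has_derivative_compose[OF this B]
    have 1: "((\<lambda>x. residual ((wbar, 0, 0), (x, ybar))) has_derivative (\<lambda>h. B (h, 0))) (at xbar)" by simp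
    have F: "((\<lambda>x. F \<nu> (block owner \<nu> x, wbar)) has_derivative own_derivative \<nu>) (at xbar)" for \<nu>
      using has_derivative_compose[OF bounded_linear_imp_has_derivative[OF bounded_linear_block] own_derivative]
      by (simp add: own_derivative_block)
    have "((\<lambda>x. (0 - (\<Sum>\<nu>\<in>UNIV. own_gradient \<nu> wbar (x, ybar)),
        (\<Sum>\<nu>\<in>UNIV. F \<nu> (block owner \<nu> x, wbar)) - 0)) has_derivative
        (\<lambda>h. (0 - hessian *v h, (\<Sum>\<nu>\<in>UNIV. own_derivative \<nu> h) - 0))) (at xbar)"
      by (intro has_derivative_Pair has_derivative_diff has_derivative_const game_hessian_derivative
          has_derivative_sum F)
    then have 2: "((\<lambda>x. residual ((wbar, 0, 0), (x, ybar))) has_derivative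
        (\<lambda>h. (- (hessian *v h), \<Sum>\<nu>\<in>UNIV. own_derivative \<nu> h))) (at xbar)"
      by (simp add: residual_def)
    show ?thesis using has_derivative_unique[OF 1 2] by metis
  qed
  have By: "B (0, k) = (- (\<Sum>\<nu>\<in>UNIV. adjoint (own_derivative \<nu>) (component (Y \<nu>) k)), 0)" for k
  proof -
    have "((\<lambda>y. (xbar, y)) has_derivative (\<lambda>k. (0, k))) (at ybar)"
      by (auto intro!: derivative_eq_intros)
    from has_derivative_compose[OF this B]
    have 1: "((\<lambda>y. residual ((wbar, 0, 0), (xbar, y))) has_derivative (\<lambda>k. B (0, k))) (at ybar)" by simp
    have adj: "((\<lambda>y. adjoint (own_derivative \<nu>) (component (Y \<nu>) y)) has_derivative
        (\<lambda>k. adjoint (own_derivative \<nu>) (component (Y \<nu>) k))) (at ybar)" for \<nu>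
      using linear_compose[OF linear_component[OF Y_sub] adjoint_linear[OF linear_own_derivative]]
      by (intro bounded_linear_imp_has_derivative) (simp add: linear_conv_bounded_linear o_def)
    \<comment> \<open>With \<open>x\<close> fixed, the gradient of \<open>f \<nu>\<close> and the
      constraint value are constants, and the multiplier term is linear in \<open>y\<close>.\<close>
    have "((\<lambda>y. (0 - (\<Sum>\<nu>\<in>UNIV. block owner \<nu> (grad_x (f \<nu>) (xbar, wbar))
          + adjoint (own_derivative \<nu>) (component (Y \<nu>) y)),
        (\<Sum>\<nu>\<in>UNIV. F \<nu> (block owner \<nu> xbar, wbar)) - 0)) has_derivative
        (\<lambda>k. (0 - (\<Sum>\<nu>\<in>UNIV. 0 + adjoint (own_derivative \<nu>) (component (Y \<nu>) k)), 0 - 0))) (at ybar)"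
      by (intro has_derivative_Pair has_derivative_diff has_derivative_const
          has_derivative_sum has_derivative_add adj)
    then have 2: "((\<lambda>y. residual ((wbar, 0, 0), (xbar, y))) has_derivative
        (\<lambda>k. (- (\<Sum>\<nu>\<in>UNIV. adjoint (own_derivative \<nu>) (component (Y \<nu>) k)), 0))) (at ybar)"
      by (simp add: residual_def own_gradient_def deriv_x_eq block_adjoint_own_derivative)
    show ?thesis using has_derivative_unique[OF 1 2] by metis
  qed
  have "adjoint B (- w1, - w2) =
      (transpose hessian *v w1 - (\<Sum>\<nu>\<in>UNIV. adjoint (own_derivative \<nu>) (component (Y \<nu>) w2)),
       \<Sum>\<nu>\<in>UNIV. own_derivative \<nu> (block owner \<nu> w1))" (is "_ = ?r") for w1 w2
  proof -
    have "z \<bullet> adjoint B (- w1, - w2) = z \<bullet> ?r" for z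
    proof -
      obtain h k where z: "z = (h, k)" by (cases z)
      have G: "(hessian *v h) \<bullet> w1 = h \<bullet> (transpose hessian *v w1)"
        using adjoint_works[of "\<lambda>x. hessian *v x" h w1] by (simp add: adjoint_matrix)
      have 1: "adjoint (own_derivative \<nu>) (component (Y \<nu>) k) \<bullet> w1 = k \<bullet> own_derivative \<nu> w1" for \<nu>
        using component_inner(2)[OF Y_sub own_derivative_in, of \<nu> w1 k]
          adjoint_own_derivative[of w1 \<nu> "component (Y \<nu>) k"] by (simp add: inner_commute)
      have 2: "own_derivative \<nu> h \<bullet> w2 = h \<bullet> adjoint (own_derivative \<nu>) (component (Y \<nu>) w2)" for \<nu>
        using component_inner(2)[OF Y_sub own_derivative_in] by (simp add: adjoint_own_derivative)
      have "z \<bullet> adjoint B (- w1, - w2) = B (h, k) \<bullet> (- w1, - w2)"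
        using adjoint_works[of B z] B.linear by (simp add: z)
      also have "B (h, k) = B (h, 0) + B (0, k)" by (simp flip: B.add)
      finally show ?thesis
        by (simp add: z Bx By G 1 2 inner_add_left inner_diff_left inner_diff_right inner_sum_left inner_sum_right own_derivative_block)
    qed
    then show ?thesis using vector_eq_ldot by blast
  qed
  with B show thesis by (rule that)
qed

end

section \<open>Reduction of the game to a generalized equation\<close>

theorem theorem4p1:
  fixes owner :: "'n::finite \<Rightarrow> 'p::finite"
    and Y :: "'p \<Rightarrow> 'y::euclidean_space set"
    and X :: "'p \<Rightarrow> (real^'n) set"
    and K :: "'p \<Rightarrow> 'y set"
    and f :: "'p \<Rightarrow> (real^'n) \<times> (real^'d::finite) \<Rightarrow> real"
    and F :: "'p \<Rightarrow> (real^'n) \<times> (real^'d) \<Rightarrow> 'y"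
    and wbar :: "real^'d" and xbar :: "real^'n" and ybar :: 'y
  assumes Y: "orthogonal_decomposition Y"
    and X: "\<And>\<nu>. X \<nu> \<subseteq> block_space owner \<nu>" "\<And>\<nu>. X \<nu> \<noteq> {}" "\<And>\<nu>. closed (X \<nu>)" "\<And>\<nu>. convex (X \<nu>)"
    and K: "\<And>\<nu>. K \<nu> \<subseteq> Y \<nu>" "\<And>\<nu>. K \<nu> \<noteq> {}" "\<And>\<nu>. closed (K \<nu>)" "\<And>\<nu>. convex (K \<nu>)" "\<And>\<nu>. cone (K \<nu>)"
    and F_own: "\<And>\<nu> x w. F \<nu> (x, w) = F \<nu> (block owner \<nu> x, w)"
    and F_range: "\<And>\<nu> x w. F \<nu> (x, w) \<in> Y \<nu>"
    and sol: "(xbar, ybar) \<in> S_Lag owner Y X K f F (wbar, 0, 0)"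
    and f_smooth: "\<And>\<nu>. \<exists>U. open U \<and> (xbar, wbar) \<in> U \<and>
          (\<forall>x w. (x, w) \<in> U \<longrightarrow>
             (\<lambda>z. f \<nu> (z, w)) differentiable (at x) \<and>
             (\<lambda>z. grad_x (f \<nu>) (z, w)) differentiable (at x) \<and>
             strictly_differentiable_at (f \<nu>) (x, w) \<and>
             strictly_differentiable_at (grad_x (f \<nu>)) (x, w))"
    and F_smooth: "\<And>\<nu>. \<exists>U. open U \<and> (block owner \<nu> xbar, wbar) \<in> U \<and>
          (\<forall>x w. (x, w) \<in> U \<longrightarrow>
             (\<lambda>z. F \<nu> (z, w)) differentiable (at x) \<and>
             (\<lambda>z. deriv_x (F \<nu>) (z, w)) differentiable (at x) \<and>
             strictly_differentiable_at (F \<nu>) (x, w) \<and>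
             strictly_differentiable_at (deriv_x (F \<nu>)) (x, w))"
  shows "aubin_property (S_Lag owner Y X K f F) (wbar, 0, 0) (xbar, ybar) \<longleftrightarrow>
    (\<forall>w1 w2.
       (\<forall>\<nu>.
          block owner \<nu> (transpose (game_hessian owner Y f F wbar xbar ybar) *v w1)
            - adjoint (frechet_derivative (\<lambda>z. F \<nu> (z, wbar)) (at (block owner \<nu> xbar)))
                (component (Y \<nu>) w2)
          \<in> coderivative (block_space owner \<nu>) (block_space owner \<nu>)
              (convex_normal_cone (block_space owner \<nu>) (X \<nu>))
              (block owner \<nu> xbar)
              (- partial_gradient owner \<nu>
                   (\<lambda>z. ref_lagrangian owner f F wbar \<nu> z (component (Y \<nu>) ybar)) xbar)
              (- block owner \<nu> w1)) \<and>
       (\<forall>\<nu>.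
          frechet_derivative (\<lambda>z. F \<nu> (z, wbar)) (at (block owner \<nu> xbar)) (block owner \<nu> w1)
          \<in> coderivative (Y \<nu>) (Y \<nu>)
              (convex_normal_cone (Y \<nu>) (polar_cone (Y \<nu>) (K \<nu>)))
              (component (Y \<nu>) ybar)
              (F \<nu> (block owner \<nu> xbar, wbar))
              (- component (Y \<nu>) w2))
       \<longrightarrow> w1 = 0 \<and> w2 = 0)"
proof -
  \<comment> \<open>The neighbourhood for the constraint lives at the own block, so it is pulled
    back along the block projection before being intersected with the one for the objective.
    Finiteness of the player set then allows a common \<open>U\<close>.\<close>
  have "\<exists>V. open V \<and> (xbar, wbar) \<in> V \<and> (\<forall>x w. (x, w) \<in> V \<longrightarrow>
      (\<lambda>z. f \<nu> (z, w)) differentiable (at x) \<and>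
      strictly_differentiable_at (grad_x (f \<nu>)) (x, w) \<and>
      (\<lambda>z. F \<nu> (z, w)) differentiable (at (block owner \<nu> x)) \<and>
      strictly_differentiable_at (F \<nu>) (block owner \<nu> x, w) \<and>
      strictly_differentiable_at (deriv_x (F \<nu>)) (block owner \<nu> x, w))" for \<nu>
  proof -
    obtain Uf where Uf: "open Uf" "(xbar, wbar) \<in> Uf" "\<And>x w. (x, w) \<in> Uf \<Longrightarrow>
        (\<lambda>z. f \<nu> (z, w)) differentiable (at x) \<and> strictly_differentiable_at (grad_x (f \<nu>)) (x, w)"
      using f_smooth[of \<nu>] by blast
    obtain UF where UF: "open UF" "(block owner \<nu> xbar, wbar) \<in> UF" "\<And>x w. (x, w) \<in> UF \<Longrightarrow>
        (\<lambda>z. F \<nu> (z, w)) differentiable (at x) \<and> strictly_differentiable_at (F \<nu>) (x, w) \<and>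
        strictly_differentiable_at (deriv_x (F \<nu>)) (x, w)"
      using F_smooth[of \<nu>] by blast
    have "open ((\<lambda>(x, w). (block owner \<nu> x, w)) -` UF)"
      unfolding case_prod_beta'
      by (intro open_vimage UF(1) continuous_intros bounded_linear.continuous_on[OF bounded_linear_block])
    then show ?thesis
      using Uf UF by (intro exI[of _ "Uf \<inter> (\<lambda>(x, w). (block owner \<nu> x, w)) -` UF"]) (auto simp: open_Int)
  qed
  then obtain V where V: "\<And>\<nu>. open (V \<nu>)" "\<And>\<nu>. (xbar, wbar) \<in> V \<nu>"
    "\<And>\<nu> x w. (x, w) \<in> V \<nu> \<Longrightarrow>
      (\<lambda>z. f \<nu> (z, w)) differentiable (at x) \<and>
      strictly_differentiable_at (grad_x (f \<nu>)) (x, w) \<and>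
      (\<lambda>z. F \<nu> (z, w)) differentiable (at (block owner \<nu> x)) \<and>
      strictly_differentiable_at (F \<nu>) (block owner \<nu> x, w) \<and>
      strictly_differentiable_at (deriv_x (F \<nu>)) (block owner \<nu> x, w)"
    by metis
  define U where "U = (\<Inter>\<nu>. V \<nu>)"
  have U: "open U" "(xbar, wbar) \<in> U" using V(1,2) by (auto simp: U_def intro: open_INT)
  have UV: "(x, w) \<in> V \<nu>" if "(x, w) \<in> U" for x w \<nu> using that by (simp add: U_def)
  interpret game: smooth_game owner Y f F wbar xbar ybar U
  proof
    show "orthogonal_decomposition Y" by (rule Y)
    show "F \<nu> (x, w) = F \<nu> (block owner \<nu> x, w)" "F \<nu> (x, w) \<in> Y \<nu>" for \<nu> x w
      by (rule F_own, rule F_range)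
    show "open U" "(xbar, wbar) \<in> U" by (rule U)+
  qed (use V(3) UV in blast)+
  let ?E = "block_space owner"
  let ?M = "\<lambda>\<nu>. convex_normal_cone (?E \<nu>) (X \<nu>)"
  let ?N = "\<lambda>\<nu>. convex_normal_cone (Y \<nu>) (polar_cone (Y \<nu>) (K \<nu>))"
  let ?Dg = "\<lambda>\<nu>. frechet_derivative (\<lambda>z. F \<nu> (z, wbar)) (at (block owner \<nu> xbar))"
  let ?G = "game_hessian owner Y f F wbar xbar ybar"
  define T where "T = product_mapping ?E ?M Y ?N"
  define H where "H = game.residual"
  note Y_sub = decomposition_subspace[OF Y]
  have closed: "closed (gph T)"
    unfolding T_def
    by (intro closed_gph_product_mapping closed_gph_convex_normal_cone closed_polar_cone closed_subspace
        subspace_block_space Y_sub X(3))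
  obtain B where B: "((\<lambda>z. H ((wbar, 0, 0), z)) has_derivative B) (at (xbar, ybar))"
    "\<And>w1 w2. adjoint B (- w1, - w2) =
      (transpose ?G *v w1 - (\<Sum>\<nu>\<in>UNIV. adjoint (?Dg \<nu>) (component (Y \<nu>) w2)),
       \<Sum>\<nu>\<in>UNIV. ?Dg \<nu> (block owner \<nu> w1))"
    by (rule game.residual_derivative) (rule that[unfolded H_def])
  define W where "W = (\<lambda>c :: ((real^'d) \<times> (real^'n) \<times> 'y) \<times> ((real^'n) \<times> 'y). (fst (snd c), fst (fst c))) -` U"
  have W: "open W" "((wbar, 0, 0), (xbar, ybar)) \<in> W"
    using U unfolding W_def by (auto intro!: open_vimage continuous_intros)
  have S_iff: "z \<in> S_Lag owner Y X K f F p \<longleftrightarrow> H (p, z) \<in> T z" if "(p, z) \<in> W" for p z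
    using game.S_Lag_iff_residual that unfolding H_def T_def W_def by (cases p; cases z) auto
  have H_strict: "strictly_differentiable_at H (p, z)" if "(p, z) \<in> W" for p z
    using game.residual_strict that unfolding H_def W_def by simp
  interpret ge: generalized_equation H T "S_Lag owner Y X K f F" "(wbar, 0, 0)" "(xbar, ybar)" B W
    by unfold_locales (fact closed W S_iff H_strict sol B(1))+
  \<comment> \<open>The canonical perturbation: \<open>v\<close> enters the residual with sign plus
    and \<open>u\<close> with sign minus, so this direction shifts the residual by exactly
    \<open>e\<close>.\<close>
  let ?j = "\<lambda>e :: (real^'n) \<times> 'y. (0 :: real^'d, fst e, - snd e)"
  have j: "bounded_linear ?j" "H (p + ?j e, z) = H (p, z) + e" for p e z
    by (auto intro!: bounded_linear_intros bounded_linear_minus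
        simp: H_def game.residual_def prod_eq_iff split: prod.splits)
  have "aubin_property (S_Lag owner Y X K f F) (wbar, 0, 0) (xbar, ybar) \<longleftrightarrow>
    (\<forall>\<zeta>. adjoint B \<zeta> \<in> coderivative UNIV UNIV T (xbar, ybar) (H ((wbar, 0, 0), (xbar, ybar))) \<zeta> \<longrightarrow> \<zeta> = 0)"
    using ge.aubin_imp_coderivative_kernel[OF j] ge.coderivative_kernel_imp_aubin by blast
  also have "\<dots> \<longleftrightarrow> (\<forall>w1 w2. adjoint B (- w1, - w2) \<in>
      coderivative UNIV UNIV T (xbar, ybar) (H ((wbar, 0, 0), (xbar, ybar))) (- w1, - w2) \<longrightarrow> w1 = 0 \<and> w2 = 0)"
    (is "(\<forall>\<zeta>. ?P \<zeta> \<longrightarrow> \<zeta> = 0) \<longleftrightarrow> ?Q")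
  proof
    assume Q: ?Q
    show "\<forall>\<zeta>. ?P \<zeta> \<longrightarrow> \<zeta> = 0"
    proof (intro allI impI)
      fix \<zeta> assume "?P \<zeta>"
      then show "\<zeta> = 0" using Q[rule_format, of "- fst \<zeta>" "- snd \<zeta>"] by (simp add: prod_eq_iff)
    qed
  qed (fastforce simp: zero_prod_def)
  finally have "aubin_property (S_Lag owner Y X K f F) (wbar, 0, 0) (xbar, ybar) \<longleftrightarrow> ?Q" .
  moreover have "adjoint B (- w1, - w2) \<in>
      coderivative UNIV UNIV T (xbar, ybar) (H ((wbar, 0, 0), (xbar, ybar))) (- w1, - w2) \<longleftrightarrow>
    (\<forall>\<nu>. block owner \<nu> (transpose ?G *v w1) - adjoint (?Dg \<nu>) (component (Y \<nu>) w2)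
       \<in> coderivative (?E \<nu>) (?E \<nu>) (?M \<nu>) (block owner \<nu> xbar)
           (- partial_gradient owner \<nu> (\<lambda>z. ref_lagrangian owner f F wbar \<nu> z (component (Y \<nu>) ybar)) xbar)
           (- block owner \<nu> w1)) \<and>
    (\<forall>\<nu>. ?Dg \<nu> (block owner \<nu> w1)
       \<in> coderivative (Y \<nu>) (Y \<nu>) (?N \<nu>) (component (Y \<nu>) ybar) (F \<nu> (block owner \<nu> xbar, wbar))
           (- component (Y \<nu>) w2))" for w1 w2
  proof -
    obtain h1 h2 where h: "H ((wbar, 0, 0), (xbar, ybar)) = (h1, h2)"
      by (cases "H ((wbar, 0, 0), (xbar, ybar))")
    have h1: "block owner \<nu> h1
        = - partial_gradient owner \<nu> (\<lambda>z. ref_lagrangian owner f F wbar \<nu> z (component (Y \<nu>) ybar)) xbar" for \<nu>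
      using game.block_residual[of \<nu> wbar 0 0 "(xbar, ybar)"]
        game.partial_gradient_eq[OF U(2), of \<nu> ybar 0 0] h
      by (simp add: H_def ref_lagrangian_eq linear_0[OF linear_block])
    have h2: "component (Y \<nu>) h2 = F \<nu> (block owner \<nu> xbar, wbar)" for \<nu>
      using game.component_residual[of \<nu> wbar 0 0 "(xbar, ybar)"] h
      by (simp add: H_def linear_0[OF linear_component[OF Y_sub]])
    \<comment> \<open>Each adjoint term lies in its player's own block, so the projection onto block
      \<nu> keeps only the term of player \<nu>.\<close>
    have a1: "block owner \<nu> (transpose ?G *v w1 - (\<Sum>\<mu>\<in>UNIV. adjoint (?Dg \<mu>) (component (Y \<mu>) w2)))
        = block owner \<nu> (transpose ?G *v w1) - adjoint (?Dg \<nu>) (component (Y \<nu>) w2)" for \<nu>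
    proof -
      have "adjoint (?Dg \<mu>) (component (Y \<mu>) w2) \<in> ?E \<mu>" for \<mu>
        using game.block_adjoint_own_derivative[of \<mu> "component (Y \<mu>) w2"] block_in by metis
      from component_sum[OF orthogonal_decomposition_block_space this]
      show ?thesis by (simp add: linear_diff[OF linear_block] component_block_space)
    qed
    have a2: "component (Y \<nu>) (\<Sum>\<mu>\<in>UNIV. ?Dg \<mu> (block owner \<mu> w1)) = ?Dg \<nu> (block owner \<nu> w1)" for \<nu>
      by (rule component_sum[OF Y game.own_derivative_in])
    have M: "gph (?M \<nu>) \<subseteq> ?E \<nu> \<times> ?E \<nu>" for \<nu>
      by (rule gph_convex_normal_cone_subset[OF X(1)])
    have N: "gph (?N \<nu>) \<subseteq> Y \<nu> \<times> Y \<nu>" for \<nu>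
      by (rule gph_convex_normal_cone_subset) (auto simp: polar_cone_def)
    show ?thesis
      unfolding B(2) h T_def
        coderivative_product_mapping[OF orthogonal_decomposition_block_space Y M N]
      by (simp only: component_block_space a1 a2 h1 h2 linear_neg[OF linear_block]
          linear_neg[OF linear_component[OF Y_sub]])
  qed
  ultimately show ?thesis by (simp only:)
qed

end
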